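(* The language preservation problem for parametric timed automata with one parameter is undecidable. This holds both over continuous (real-valued) time and over discrete (integer-valued) time, and both for rational-valued and for integer-valued parameter valuations.
   Context: Clocks are real-valued variables $x\in X$ (integer-valued in the discrete-time setting); parameters are variables $p\in P$ taking nonnegative rational values (nonnegative integer values in the integer-parameter setting). An atomic constraint has the form $x\sim p+c$, $x\sim c$, or $p\sim c$, with $\sim\in\{<,\le,=,\ge,>\}$, $x\in X$, $p\in P$, $c\in\mathbb Z$ (also true/false); a constraint is a conjunction of atomic constraints. A parametric timed automaton (PTA) is a tuple $(\Sigma,L,\ell_0,X,P,I,E)$ with finite action alphabet $\Sigma$, finite set of locations $L$, initial location $\ell_0$, invariants $I(\ell)$ (constraints) and finite set of edges $(\ell,g,a,R,\ell')$ with guard constraint $g$, action $a\in\Sigma$, reset set $R\subseteq X$. For a parameter valuation $v$, $v(\mathcal A)$ is the timed automaton obtained by replacing each parameter by its value. Its configurations are pairs $(\ell,w)$ with $w$ a clock valuation satisfying $v(I(\ell))$; initial configuration $(\ell_0,\mathbf 0)$; there is a step $(\ell,w)\xrightarrow{d,e}(\ell',w')$ for $d\ge 0$ and edge $e=(\ell,g,a,R,\ell')$ when $w+d$ satisfies $v(g)$ and $w'=(w+d)[R\mapsto 0]$ (with $(\ell',w')$ a valid configuration). A run is a maximal sequence of consecutive steps from the initial configuration (finite only if its last configuration has no outgoing step). The untimed word of a run is its sequence of actions; the untimed language $\mathcal L(v(\mathcal A))$ is the set of untimed words of runs. The language preservation problem: given a PTA $\mathcal A$ and a parameter valuation $v$,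 decide whether there exists a parameter valuation $v'\neq v$ with $\mathcal L(v(\mathcal A))=\mathcal L(v'(\mathcal A))$. *)

theory Defs
  imports Complex_Main "HOL-Library.Nat_Bijection"
begin

section \<open>Partial recursive functions and decision problems\<close>

datatype recf =
    Zero
  | Succ
  | Proj nat
  | Comp recf "recf list"
  | PrimRec recf recf
  | Mu recf

inductive computes :: "recf \<Rightarrow> nat list \<Rightarrow> nat \<Rightarrow> bool" where
  "computes Zero xs 0"
| "computes Succ [x] (Suc x)"
| "i < length xs \<Longrightarrow> computes (Proj i) xs (xs ! i)"
| "list_all2 (\<lambda>g y. computes g xs y) gs ys \<Longrightarrow> computes f ys z \<Longrightarrow> computes (Comp f gs) xs z"
| "computes f xs y \<Longrightarrow> computes (PrimRec f g) (0 # xs) y"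
| "computes (PrimRec f g) (n # xs) y \<Longrightarrow> computes g (n # y # xs) z
    \<Longrightarrow> computes (PrimRec f g) (Suc n # xs) z"
| "computes f (n # xs) 0 \<Longrightarrow> (\<forall>m<n. \<exists>y>0. computes f (m # xs) y) \<Longrightarrow> computes (Mu f) xs n"

inductive_cases computes_ZeroE: "computes Zero xs y"
inductive_cases computes_SuccE: "computes Succ xs y"
inductive_cases computes_ProjE: "computes (Proj i) xs y"
inductive_cases computes_CompE: "computes (Comp f gs) xs y"
inductive_cases computes_PrimRec_0E: "computes (PrimRec f g) (0 # xs) y"
inductive_cases computes_PrimRec_SucE: "computes (PrimRec f g) (Suc n # xs) y"
inductive_cases computes_MuE: "computes (Mu f) xs y"

lemma computes_functional: "computes f xs y \<Longrightarrow> computes f xs z \<Longrightarrow> y = z"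
proof (induction arbitrary: z rule: computes.induct)
  case (1 xs)
  then show ?case by (rule computes_ZeroE) simp
next
  case (2 x)
  then show ?case by (rule computes_SuccE) simp
next
  case (3 i xs)
  from "3.prems" show ?case by (rule computes_ProjE) simp
next
  case (4 xs gs ys f u)
  from "4.prems" obtain ys' where ys': "list_all2 (\<lambda>g y. computes g xs y) gs ys'" "computes f ys' z"
    by (rule computes_CompE)
  have "ys = ys'"
    using "4.IH"(1) ys'(1) by (auto simp: list_all2_conv_all_nth intro!: nth_equalityI)
  with ys' "4.IH"(2) show ?case by simp
next
  case (5 f xs y g)
  from "5.prems" have "computes f xs z" by (rule computes_PrimRec_0E)
  then show ?case by (rule "5.IH")
next
  case (6 f g n xs y u)
  from "6.prems" obtain y' where "computes (PrimRec f g) (n # xs) y'" "computes g (n # y' # xs) z"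
    by (rule computes_PrimRec_SucE)
  with "6.IH" show ?case by blast
next
  case (7 f n xs)
  from "7.prems" have z: "computes f (z # xs) 0" "\<forall>m<z. \<exists>y>0. computes f (m # xs) y"
    by (rule computes_MuE, simp)+
  show ?case
  proof (rule linorder_cases[of n z])
    assume "n < z"
    with z(2) "7.IH"(1) show ?thesis by fastforce
  next
    assume "z < n"
    with z(1) "7.IH"(2) show ?thesis by fastforce
  qed
qed

text \<open>
  A decision problem has a set of instances, an encoding of instances as natural numbers and a
  set of positive instances. The algorithm must halt with the correct answer on the code of
  every instance; nothing is required on other inputs.
\<close>

definition decidable :: "('i \<Rightarrow> nat) \<Rightarrow> 'i set \<Rightarrow> ('i \<Rightarrow> bool) \<Rightarrow> bool" where
  "decidable code Inst Q \<longleftrightarrow> (\<exists>f. \<forall>i\<in>Inst. computes f [code i] (if Q i then 1 else 0))"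


section \<open>Parametric timed automata\<close>

datatype rel = Lt | Le | Eq | Ge | Gt

text \<open>\<open>ClockParam x r p c\<close> stands for \<open>x r p + c\<close>.\<close>

datatype ('x, 'p) atom =
    Top
  | Bot
  | ClockParam 'x rel 'p int
  | ClockConst 'x rel int
  | ParamConst 'p rel int

type_synonym ('x, 'p) constr = "('x, 'p) atom list"

type_synonym ('a, 'l, 'x, 'p) edge = "'l \<times> ('x, 'p) constr \<times> 'a \<times> 'x set \<times> 'l"

record ('a, 'l, 'x, 'p) pta =
  alphabet :: "'a set"
  locs :: "'l set"
  init :: 'l
  clocks :: "'x set"
  params :: "'p set"
  invariant :: "'l \<Rightarrow> ('x, 'p) constr"
  edges :: "('a, 'l, 'x, 'p) edge set"

fun atom_over :: "'x set \<Rightarrow> 'p set \<Rightarrow> ('x, 'p) atom \<Rightarrow> bool" where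
  "atom_over X P Top \<longleftrightarrow> True"
| "atom_over X P Bot \<longleftrightarrow> True"
| "atom_over X P (ClockParam x r p c) \<longleftrightarrow> x \<in> X \<and> p \<in> P"
| "atom_over X P (ClockConst x r c) \<longleftrightarrow> x \<in> X"
| "atom_over X P (ParamConst p r c) \<longleftrightarrow> p \<in> P"

definition constr_over :: "'x set \<Rightarrow> 'p set \<Rightarrow> ('x, 'p) constr \<Rightarrow> bool" where
  "constr_over X P g \<longleftrightarrow> (\<forall>\<alpha>\<in>set g. atom_over X P \<alpha>)"

text \<open>The values of \<^const>\<open>invariant\<close> outside \<^const>\<open>locs\<close> are irrelevant.\<close>

definition is_pta :: "('a, 'l, 'x, 'p) pta \<Rightarrow> bool" where
  "is_pta A \<longleftrightarrow>
     finite (alphabet A) \<and> finite (locs A) \<and> finite (clocks A) \<and> finite (params A) \<and>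
     finite (edges A) \<and> init A \<in> locs A \<and>
     (\<forall>l\<in>locs A. constr_over (clocks A) (params A) (invariant A l)) \<and>
     (\<forall>(l, g, a, R, l')\<in>edges A. l \<in> locs A \<and> constr_over (clocks A) (params A) g \<and>
        a \<in> alphabet A \<and> R \<subseteq> clocks A \<and> l' \<in> locs A)"


subsection \<open>Semantics\<close>

fun rel_holds :: "rel \<Rightarrow> real \<Rightarrow> real \<Rightarrow> bool" where
  "rel_holds Lt s t \<longleftrightarrow> s < t"
| "rel_holds Le s t \<longleftrightarrow> s \<le> t"
| "rel_holds Eq s t \<longleftrightarrow> s = t"
| "rel_holds Ge s t \<longleftrightarrow> s \<ge> t"
| "rel_holds Gt s t \<longleftrightarrow> s > t"

fun sat_atom :: "('p \<Rightarrow> rat) \<Rightarrow> ('x \<Rightarrow> real) \<Rightarrow> ('x, 'p) atom \<Rightarrow> bool" where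
  "sat_atom v w Top \<longleftrightarrow> True"
| "sat_atom v w Bot \<longleftrightarrow> False"
| "sat_atom v w (ClockParam x r p c) \<longleftrightarrow> rel_holds r (w x) (of_rat (v p) + of_int c)"
| "sat_atom v w (ClockConst x r c) \<longleftrightarrow> rel_holds r (w x) (of_int c)"
| "sat_atom v w (ParamConst p r c) \<longleftrightarrow> rel_holds r (of_rat (v p)) (of_int c)"

definition sat :: "('p \<Rightarrow> rat) \<Rightarrow> ('x \<Rightarrow> real) \<Rightarrow> ('x, 'p) constr \<Rightarrow> bool" where
  "sat v w g \<longleftrightarrow> (\<forall>\<alpha>\<in>set g. sat_atom v w \<alpha>)"

text \<open>
  The time domain \<open>T\<close> (a set of reals) is the range of both clock values and delays:
  \<open>{0..}\<close> for continuous time, \<open>\<nat>\<close> for discrete time. Clock valuations are total functions; the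
  values of names outside \<^const>\<open>clocks\<close> are never inspected.
\<close>

definition is_config ::
    "real set \<Rightarrow> ('a, 'l, 'x, 'p) pta \<Rightarrow> ('p \<Rightarrow> rat) \<Rightarrow> 'l \<times> ('x \<Rightarrow> real) \<Rightarrow> bool" where
  "is_config T A v = (\<lambda>(l, w). l \<in> locs A \<and> (\<forall>x. w x \<in> T) \<and> sat v w (invariant A l))"

definition init_config :: "('a, 'l, 'x, 'p) pta \<Rightarrow> 'l \<times> ('x \<Rightarrow> real)" where
  "init_config A = (init A, \<lambda>x. 0)"

text \<open>
  The guard is evaluated after the delay. Invariants are conditions on configurations only: the
  valuations passed through during a delay need not satisfy the invariant of the source location.
\<close>

definition step ::
    "real set \<Rightarrow> ('a, 'l, 'x, 'p) pta \<Rightarrow> ('p \<Rightarrow> rat) \<Rightarrow> 'l \<times> ('x \<Rightarrow> real)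
       \<Rightarrow> real \<Rightarrow> ('a, 'l, 'x, 'p) edge \<Rightarrow> 'l \<times> ('x \<Rightarrow> real) \<Rightarrow> bool" where
  "step T A v = (\<lambda>(l, w) d (k, g, a, R, k') (l', w').
     is_config T A v (l, w) \<and> is_config T A v (l', w') \<and>
     d \<in> T \<and> d \<ge> 0 \<and> (k, g, a, R, k') \<in> edges A \<and> k = l \<and> k' = l' \<and>
     sat v (\<lambda>x. w x + d) g \<and> w' = (\<lambda>x. if x \<in> R then 0 else w x + d))"

definition action :: "('a, 'l, 'x, 'p) edge \<Rightarrow> 'a" where
  "action = (\<lambda>(l, g, a, R, l'). a)"

text \<open>
  A run is given by its configurations \<open>c\<close>, delays \<open>d\<close> and edges \<open>e\<close>; in a finite run with \<open>n\<close>
  steps only the first \<open>n + 1\<close> configurations and the first \<open>n\<close> delays and edges matter.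
\<close>

definition finite_run ::
    "real set \<Rightarrow> ('a, 'l, 'x, 'p) pta \<Rightarrow> ('p \<Rightarrow> rat) \<Rightarrow> nat \<Rightarrow>
       (nat \<Rightarrow> 'l \<times> ('x \<Rightarrow> real)) \<Rightarrow> (nat \<Rightarrow> real) \<Rightarrow> (nat \<Rightarrow> ('a, 'l, 'x, 'p) edge) \<Rightarrow> bool" where
  "finite_run T A v n c d e \<longleftrightarrow>
     c 0 = init_config A \<and> is_config T A v (c 0) \<and>
     (\<forall>i<n. step T A v (c i) (d i) (e i) (c (Suc i))) \<and>
     \<not> (\<exists>d' e' c'. step T A v (c n) d' e' c')"

definition infinite_run ::
    "real set \<Rightarrow> ('a, 'l, 'x, 'p) pta \<Rightarrow> ('p \<Rightarrow> rat) \<Rightarrow>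
       (nat \<Rightarrow> 'l \<times> ('x \<Rightarrow> real)) \<Rightarrow> (nat \<Rightarrow> real) \<Rightarrow> (nat \<Rightarrow> ('a, 'l, 'x, 'p) edge) \<Rightarrow> bool" where
  "infinite_run T A v c d e \<longleftrightarrow>
     c 0 = init_config A \<and> is_config T A v (c 0) \<and>
     (\<forall>i. step T A v (c i) (d i) (e i) (c (Suc i)))"

datatype 'a word = Fin "'a list" | Inf "nat \<Rightarrow> 'a"

definition untimed_language ::
    "real set \<Rightarrow> ('a, 'l, 'x, 'p) pta \<Rightarrow> ('p \<Rightarrow> rat) \<Rightarrow> 'a word set" where
  "untimed_language T A v =
     {Fin (map (action \<circ> e) [0..<n]) | n c d e. finite_run T A v n c d e} \<union>
     {Inf (action \<circ> e) | c d e. infinite_run T A v c d e}"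


section \<open>The language preservation problem\<close>

text \<open>The parameter domain \<open>V\<close> is \<open>{0..}\<close> for rational-valued, \<open>\<nat>\<close> for integer-valued parameters.\<close>

definition is_valuation :: "rat set \<Rightarrow> ('a, 'l, 'x, 'p) pta \<Rightarrow> ('p \<Rightarrow> rat) \<Rightarrow> bool" where
  "is_valuation V A v \<longleftrightarrow> (\<forall>p\<in>params A. v p \<in> V)"

definition language_preservable ::
    "real set \<Rightarrow> rat set \<Rightarrow> ('a, 'l, 'x, 'p) pta \<times> ('p \<Rightarrow> rat) \<Rightarrow> bool" where
  "language_preservable T V = (\<lambda>(A, v).
     \<exists>v'. is_valuation V A v' \<and> (\<exists>p\<in>params A. v' p \<noteq> v p) \<and>
          untimed_language T A v = untimed_language T A v')"

text \<open>Actions, locations, clocks and parameters of an instance are named by natural numbers.\<close>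

type_synonym nat_pta = "(nat, nat, nat, nat) pta"

definition instances :: "nat \<Rightarrow> rat set \<Rightarrow> (nat_pta \<times> (nat \<Rightarrow> rat)) set" where
  "instances k V = {(A, v). is_pta A \<and> card (params A) = k \<and> is_valuation V A v}"


subsection \<open>Encoding of instances\<close>

fun rel_code :: "rel \<Rightarrow> nat" where
  "rel_code Lt = 0"
| "rel_code Le = 1"
| "rel_code Eq = 2"
| "rel_code Ge = 3"
| "rel_code Gt = 4"

fun atom_code :: "(nat, nat) atom \<Rightarrow> nat" where
  "atom_code Top = list_encode [0]"
| "atom_code Bot = list_encode [1]"
| "atom_code (ClockParam x r p c) = list_encode [2, x, rel_code r, p, int_encode c]"
| "atom_code (ClockConst x r c) = list_encode [3, x, rel_code r, int_encode c]"
| "atom_code (ParamConst p r c) = list_encode [4, p, rel_code r, int_encode c]"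

definition constr_code :: "(nat, nat) constr \<Rightarrow> nat" where
  "constr_code g = list_encode (map atom_code g)"

definition edge_code :: "(nat, nat, nat, nat) edge \<Rightarrow> nat" where
  "edge_code = (\<lambda>(l, g, a, R, l'). list_encode [l, constr_code g, a, set_encode R, l'])"

definition pta_code :: "nat_pta \<Rightarrow> nat" where
  "pta_code A = list_encode
     [set_encode (alphabet A), set_encode (locs A), init A, set_encode (clocks A),
      set_encode (params A),
      list_encode (map (constr_code \<circ> invariant A) (sorted_list_of_set (locs A))),
      set_encode (edge_code ` edges A)]"

definition rat_code :: "rat \<Rightarrow> nat" where
  "rat_code q = (case quotient_of q of (a, b) \<Rightarrow> prod_encode (int_encode a, int_encode b))"

definition instance_code :: "nat_pta \<times> (nat \<Rightarrow> rat) \<Rightarrow> nat" where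
  "instance_code = (\<lambda>(A, v). prod_encode
     (pta_code A, list_encode (map (rat_code \<circ> v) (sorted_list_of_set (params A)))))"

text \<open>The encoding determines an instance up to irrelevant function values.\<close>

lemma rel_code_eq_iff: "rel_code r = rel_code s \<longleftrightarrow> r = s"
  by (cases r; cases s) auto

lemma inj_atom_code: "inj atom_code"
proof (rule injI)
  fix \<alpha> \<beta> assume "atom_code \<alpha> = atom_code \<beta>"
  then show "\<alpha> = \<beta>"
    by (cases \<alpha>; cases \<beta>; simp add: rel_code_eq_iff list_encode_eq int_encode_eq del: list_encode.simps)
qed

lemma constr_code_eq_iff: "constr_code g = constr_code h \<longleftrightarrow> g = h"
  by (simp add: constr_code_def list_encode_eq inj_map_eq_map[OF inj_atom_code])

lemma inj_on_edge_code: "inj_on edge_code {(l, g, a, R, l'). finite R}"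
  by (auto simp: inj_on_def edge_code_def constr_code_eq_iff list_encode_eq set_encode_eq simp del: list_encode.simps)

lemma rat_code_eq_iff: "rat_code q = rat_code r \<longleftrightarrow> q = r"
  by (auto simp: rat_code_def int_encode_eq split: prod.splits intro: quotient_of_inject)

lemma instance_code_inject:
  assumes A: "is_pta A" and B: "is_pta B"
    and eq: "instance_code (A, u) = instance_code (B, v)"
  shows "alphabet A = alphabet B" "locs A = locs B" "init A = init B" "clocks A = clocks B"
    "params A = params B" "\<forall>l\<in>locs A. invariant A l = invariant B l" "edges A = edges B"
    "\<forall>p\<in>params A. u p = v p"
proof -
  have fin: "finite (alphabet A)" "finite (locs A)" "finite (clocks A)" "finite (params A)"
      "finite (edges A)" "finite (alphabet B)" "finite (locs B)" "finite (clocks B)"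
      "finite (params B)" "finite (edges B)"
    using A B unfolding is_pta_def by blast+
  have finR: "finite R" if C: "is_pta C" and e: "(l, g, a, R, l') \<in> edges C"
    for l g a R l' and C :: nat_pta
  proof (rule finite_subset)
    have "\<forall>(l, g, a, R, l')\<in>edges C. R \<subseteq> clocks C"
      using C unfolding is_pta_def by fast
    from bspec[OF this e] show "R \<subseteq> clocks C" by simp
    show "finite (clocks C)" using C by (simp add: is_pta_def)
  qed
  have sub: "edges A \<subseteq> {(l, g, a, R, l'). finite R}" "edges B \<subseteq> {(l, g, a, R, l'). finite R}"
    using A B by (auto intro: finR)
  note eqs = eq[unfolded instance_code_def pta_code_def prod.case prod_encode_eq
    list_encode_eq Pair_inject list.inject]
  show 1: "alphabet A = alphabet B" "locs A = locs B" "init A = init B" "clocks A = clocks B"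
      "params A = params B"
    using eqs fin by (auto simp: set_encode_eq)
  have "edge_code ` edges A = edge_code ` edges B"
    using eqs fin by (auto simp: set_encode_eq)
  then show "edges A = edges B"
    using inj_on_image_eq_iff[OF inj_on_edge_code sub] by simp
  show "\<forall>l\<in>locs A. invariant A l = invariant B l"
    using eqs fin 1 by (auto simp: list_encode_eq constr_code_eq_iff)
  show "\<forall>p\<in>params A. u p = v p"
    using eqs fin 1 by (auto simp: list_encode_eq rat_code_eq_iff)
qed

end

theory Submission
  imports Defs
begin

text \<open>
  A register machine is simulated by a timed automaton with one parameter \<open>p\<close> in rounds of length
  \<open>p\<close>: a register is a clock whose value at the start of a round is the value of the register, and
  moving its reset within the round changes that value. If \<open>p\<close> is too small for the registers, the
  simulation gets stuck.

  Every location but the last, in which \<open>1\<close> is emitted forever, has an edge to a sink, so no run is finite and the language always contains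
  \<open>0\<^sup>\<omega>\<close> and is contained in the union of \<open>0\<^sup>\<omega>\<close> and all words \<open>0\<^sup>n\<^sup>+\<^sup>11\<^sup>\<omega>\<close>. For \<open>p = 0\<close> all these words are
  allowed. For \<open>p > 0\<close>, a branch in which the letters come at distance one yields those with
  \<open>n \<le> p - 1\<close> or \<open>n \<ge> p + 1\<close>. At least one value of \<open>n\<close> is missing, and it is supplied by the
  simulation if and only if that reaches the halting state. Words of length depending on \<open>p\<close> are
  needed since, for fixed \<open>p\<close>, the language is closed under limits. Hence the language for \<open>p = 0\<close> is
  preserved by some other \<open>p\<close> if and only if the machine halts.

  For undecidability, a hypothetical decision procedure is run on the code of an instance whose
  machine consists of this very procedure and halts if and only if the answer is no. The
  self-reference is obtained by passing (the code of) the edges of the automaton to the machine as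
  its input; the input is the constant in the guard of one additional edge.
\<close>

section \<open>From recursive functions to register machines\<close>

datatype com = Skip | Assign nat nat int | Seq com com | While nat com

inductive exec :: "com \<Rightarrow> (nat \<Rightarrow> nat) \<Rightarrow> (nat \<Rightarrow> nat) \<Rightarrow> bool" where
  Skip: "exec Skip s s"
| Assign: "int k = int (s b) + d \<Longrightarrow> t = s(a := k) \<Longrightarrow> exec (Assign a b d) s t"
| Seq: "exec c s t \<Longrightarrow> exec c' t u \<Longrightarrow> exec (Seq c c') s u"
| While_False: "s r = 0 \<Longrightarrow> exec (While r c) s s"
| While_True: "s r \<noteq> 0 \<Longrightarrow> exec c s t \<Longrightarrow> exec (While r c) t u \<Longrightarrow> exec (While r c) s u"

text \<open>Register \<open>0\<close> is never assigned and serves as the constant zero; it is never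
  tested either, because clock \<open>0\<close> shows \<open>p\<close> when tests are made. The
  bound \<open>d \<le> 1\<close> limits growth to one per step (\<open>register_bound\<close>), and
  \<open>0 \<le> d\<close> for \<open>a \<noteq> b\<close> makes a suitable order of resets exist
  (\<open>select_register\<close>).\<close>

fun wf_com :: "com \<Rightarrow> bool" where
  "wf_com Skip \<longleftrightarrow> True"
| "wf_com (Assign a b d) \<longleftrightarrow> 0 < a \<and> d \<le> 1 \<and> (a \<noteq> b \<longrightarrow> 0 \<le> d)"
| "wf_com (Seq c c') \<longleftrightarrow> wf_com c \<and> wf_com c'"
| "wf_com (While r c) \<longleftrightarrow> 0 < r \<and> wf_com c"

text \<open>In \<open>compile f as out n\<close>, the arguments are read from the registers \<open>as\<close>, the result is written
  to \<open>out\<close>, and the registers from \<open>n\<close> on serve as scratch space.\<close>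

fun compile :: "recf \<Rightarrow> nat list \<Rightarrow> nat \<Rightarrow> nat \<Rightarrow> com"
  and compile_args :: "recf list \<Rightarrow> nat list \<Rightarrow> nat \<Rightarrow> nat \<Rightarrow> com" where
  "compile Zero as out n = Assign out 0 0"
| "compile Succ as out n = Assign out (hd as) 1"
| "compile (Proj i) as out n = Assign out (as ! i) 0"
| "compile (Comp f gs) as out n =
     Seq (compile_args gs as n (n + length gs))
         (compile f [n..<n + length gs] out (n + length gs))"
| "compile (PrimRec f g) as out n =
     Seq (compile f (tl as) (n+1) (n+4))
    (Seq (Assign n (hd as) 0)
    (Seq (Assign (n+2) 0 0)
    (Seq (While n
           (Seq (compile g ((n+2) # (n+1) # tl as) (n+3) (n+4))
           (Seq (Assign (n+1) (n+3) 0)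
           (Seq (Assign (n+2) (n+2) 1)
                (Assign n n (- 1))))))
         (Assign out (n+1) 0))))"
| "compile (Mu f) as out n =
     Seq (Assign n 0 0)
    (Seq (compile f (n # as) (n+1) (n+2))
    (Seq (While (n+1) (Seq (Assign n n 1) (compile f (n # as) (n+1) (n+2))))
         (Assign out n 0)))"
| "compile_args [] as k n = Skip"
| "compile_args (g # gs) as k n = Seq (compile g as k n) (compile_args gs as (Suc k) n)"

section \<open>Correctness of the translation into while programs\<close>

lemma wf_compile:
  "0 < out \<Longrightarrow> 0 < n \<Longrightarrow> wf_com (compile f as out n)"
  "0 < k \<Longrightarrow> 0 < n \<Longrightarrow> wf_com (compile_args gs as k n)"
  by (induction f as out n and gs as k n rule: compile_compile_args.induct) auto

text \<open>Only the direction from \<open>computes\<close> to \<open>exec\<close> is claimed. That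
  nothing else can happen comes later from the determinism of \<open>mstep\<close>. Nothing is
  assumed about the scratch registers, so loops have to initialize theirs.\<close>

definition compile_correct :: "recf \<Rightarrow> bool" where
  "compile_correct f \<longleftrightarrow> (\<forall>as y s out n. computes f (map s as) y \<longrightarrow> (\<forall>a\<in>set as. a < n) \<longrightarrow>
     out < n \<longrightarrow> s 0 = 0 \<longrightarrow>
     (\<exists>t. exec (compile f as out n) s t \<and> t out = y \<and> (\<forall>r<n. r \<noteq> out \<longrightarrow> t r = s r)))"

lemma compile_correctD:
  assumes "compile_correct f" "computes f xs y" "map s as = xs" "\<forall>a\<in>set as. a < n" "out < n" "s 0 = 0"
  obtains t where "exec (compile f as out n) s t" "t out = y" "\<And>r. r < n \<Longrightarrow> r \<noteq> out \<Longrightarrow> t r = s r"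
  using assms unfolding compile_correct_def by blast

text \<open>The results go to consecutive registers from \<open>k\<close> on, which lie above the
  arguments and below the scratch space, so no evaluation destroys an argument or an earlier
  result.\<close>

lemma exec_compile_args:
  assumes "\<forall>g\<in>set gs. compile_correct g" "list_all2 (\<lambda>g y. computes g (map s as) y) gs ys"
    "\<forall>a\<in>set as. a < k" "k + length gs \<le> n" "s 0 = 0" "0 < k"
  shows "\<exists>t. exec (compile_args gs as k n) s t \<and> (\<forall>j<length gs. t (k + j) = ys ! j) \<and> (\<forall>r<k. t r = s r)"
  using assms
proof (induction gs arbitrary: s ys k)
  case Nil
  then show ?case by (auto intro: exec.intros)
next
  case (Cons g gs)
  from Cons.prems(2) obtain y ys' where ys: "ys = y # ys'" "computes g (map s as) y"
    "list_all2 (\<lambda>g y. computes g (map s as) y) gs ys'"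
    by (auto simp: list_all2_Cons1)
  have "\<forall>a\<in>set as. a < n" using Cons.prems by auto
  then obtain t where t: "exec (compile g as k n) s t" "t k = y" "\<And>r. r < n \<Longrightarrow> r \<noteq> k \<Longrightarrow> t r = s r"
    using compile_correctD[OF _ ys(2) refl, of n k] Cons.prems by auto
  have "map t as = map s as" using Cons.prems t(3) by force
  with ys(3) have "list_all2 (\<lambda>g y. computes g (map t as) y) gs ys'" by (simp only:)
  with Cons.IH[of t ys' "Suc k"] t(3)[of 0] Cons.prems
  obtain u where u: "exec (compile_args gs as (Suc k) n) t u"
    "\<forall>j<length gs. u (Suc k + j) = ys' ! j" "\<forall>r<Suc k. u r = t r"
    by (auto simp: less_Suc_eq)
  have "\<forall>j<length (g # gs). u (k + j) = ys ! j"
  proof (intro allI impI)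
    fix j assume "j < length (g # gs)"
    then show "u (k + j) = ys ! j" using u ys(1) t(2) by (cases j) auto
  qed
  moreover have "\<forall>r<k. u r = s r" using u(3) t(3) Cons.prems by auto
  moreover have "exec (compile_args (g # gs) as k n) s u" using t(1) u(1) by (auto intro: exec.intros)
  ultimately show ?case by blast
qed

lemma computes_PrimRec_chain:
  assumes "computes (PrimRec f g) (k # xs) y" "j \<le> k"
  shows "\<exists>z. computes (PrimRec f g) (j # xs) z"
  using assms
proof (induction k arbitrary: y)
  case (Suc k)
  then show ?case by (metis computes_PrimRec_SucE le_Suc_eq)
qed auto

text \<open>Loop invariant: register \<open>n\<close> holds the number of remaining rounds,
  \<open>n+2\<close> the current index \<open>j\<close>, and \<open>n+1\<close> the value of the
  recursion at \<open>j\<close>.\<close>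

lemma exec_PrimRec_loop:
  assumes f: "compile_correct f" and g: "compile_correct g"
    and ys: "\<And>j. j \<le> k \<Longrightarrow> computes (PrimRec f g) (j # xs) (ys j)"
  assumes "j \<le> k" "s n = k - j" "s (n+2) = j" "s (n+1) = ys j" "map s as = xs"
    "\<forall>a\<in>set as. a < n" "0 < n" "s 0 = 0"
  shows "\<exists>t. exec (While n
           (Seq (compile g ((n+2) # (n+1) # as) (n+3) (n+4))
           (Seq (Assign (n+1) (n+3) 0)
           (Seq (Assign (n+2) (n+2) 1)
                (Assign n n (- 1)))))) s t \<and> t (n+1) = ys k \<and> (\<forall>r<n. t r = s r)" (is "\<exists>t. exec ?W s t \<and> _")
  using assms(4-)
proof (induction "k - j" arbitrary: j s)
  case 0
  then show ?case by (auto intro!: exI[of _ s] exec.intros)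
next
  case (Suc i)
  then have jk: "j < k" by simp
  then have "computes (PrimRec f g) (Suc j # xs) (ys (Suc j))" by (intro ys) simp
  then have "computes g (j # ys j # xs) (ys (Suc j))"
    by (metis computes_PrimRec_SucE computes_functional jk less_imp_le ys)
  then obtain t where t: "exec (compile g ((n+2) # (n+1) # as) (n+3) (n+4)) s t" "t (n+3) = ys (Suc j)"
    "\<And>r. r < n+4 \<Longrightarrow> r \<noteq> n+3 \<Longrightarrow> t r = s r"
    using compile_correctD[OF g, of "j # ys j # xs" "ys (Suc j)" s "(n+2) # (n+1) # as" "n+4" "n+3"] Suc.prems
    by (auto simp: trans_less_add1)
  define u where "u = t(n+1 := ys (Suc j), n+2 := Suc j, n := k - Suc j)"
  have *: "exec (Seq (compile g ((n+2) # (n+1) # as) (n+3) (n+4))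
           (Seq (Assign (n+1) (n+3) 0)
           (Seq (Assign (n+2) (n+2) 1)
                (Assign n n (- 1))))) s u"
    unfolding u_def using jk t(2) t(3)[of "n+2"] t(3)[of n] Suc.prems
    by (intro exec.Seq[OF t(1)] exec.Seq[OF exec.Assign[OF _ refl]] exec.Assign) (auto simp: of_nat_diff)
  have "map u as = xs" using Suc.prems t(3) by (force simp: u_def)
  then have "\<exists>t'. exec ?W u t' \<and> t' (n+1) = ys k \<and> (\<forall>r<n. t' r = u r)"
    using Suc.prems t(3)[of 0] jk Suc.hyps(2) by (intro Suc.hyps(1)[of "Suc j"]) (auto simp: u_def)
  then obtain t' where t': "exec ?W u t'" "t' (n+1) = ys k" "\<forall>r<n. t' r = u r" by blast
  moreover have "exec ?W s t'" by (rule exec.While_True[OF _ * t'(1)]) (use jk Suc.prems in simp)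
  moreover have "\<forall>r<n. u r = s r" using t(3) by (simp add: u_def)
  ultimately show ?case by auto
qed

text \<open>Loop invariant: \<open>n\<close> holds the candidate \<open>j\<close> and
  \<open>n+1\<close> the value of \<open>f\<close> there. As \<open>computes\<close> is functional,
  this value is positive for \<open>j < k\<close> and zero for \<open>j = k\<close>, so the loop
  stops exactly at \<open>k\<close>.\<close>

lemma exec_Mu_loop:
  assumes f: "compile_correct f"
    and k: "computes f (k # xs) 0" "\<forall>j<k. \<exists>y>0. computes f (j # xs) y"
  assumes "j \<le> k" "s n = j" "computes f (j # xs) (s (n+1))" "map s as = xs"
    "\<forall>a\<in>set as. a < n" "0 < n" "s 0 = 0"
  shows "\<exists>t. exec (While (n+1) (Seq (Assign n n 1) (compile f (n # as) (n+1) (n+2)))) s t \<and>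
           t n = k \<and> (\<forall>r<n. t r = s r)" (is "\<exists>t. exec ?W s t \<and> _")
  using assms(4-)
proof (induction "k - j" arbitrary: j s)
  case 0
  then have "s (n+1) = 0" using k(1) by (auto intro: computes_functional)
  then show ?case using 0 by (auto intro!: exI[of _ s] exec.intros)
next
  case (Suc i)
  then have jk: "j < k" by simp
  with k(2) Suc.prems have nz: "s (n+1) \<noteq> 0" using computes_functional by fastforce
  obtain y where y: "computes f (Suc j # xs) y" using jk k Suc_leI[OF jk] by (metis le_neq_implies_less)
  define u where "u = s(n := Suc j)"
  have mu: "map u as = xs" using Suc.prems by (force simp: u_def)
  then obtain t where t: "exec (compile f (n # as) (n+1) (n+2)) u t" "t (n+1) = y"
    "\<And>r. r < n+2 \<Longrightarrow> r \<noteq> n+1 \<Longrightarrow> t r = u r"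
    using compile_correctD[OF f y, of u "n # as" "n+2" "n+1"] Suc.prems by (auto simp: u_def less_Suc_eq)
  have "map t as = xs" using Suc.prems t(3) mu by force
  then have "\<exists>t'. exec ?W t t' \<and> t' n = k \<and> (\<forall>r<n. t' r = t r)"
    using Suc.prems t(2) t(3)[of 0] t(3)[of n] jk Suc.hyps(2) y by (intro Suc.hyps(1)[of "Suc j"]) (auto simp: u_def)
  then obtain t' where t': "exec ?W t t'" "t' n = k" "\<forall>r<n. t' r = t r" by blast
  moreover have "exec ?W s t'"
    by (rule exec.While_True[OF nz exec.Seq[OF exec.Assign[OF _ u_def] t(1)] t'(1)])
       (use Suc.prems(2) in simp)
  moreover have "\<forall>r<n. t r = s r" using t(3) by (simp add: u_def)
  ultimately show ?case by auto
qed

lemma exec_compile: "compile_correct f"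
proof (induction f)
  case Zero
  show ?case unfolding compile_correct_def
    by (auto elim!: computes_ZeroE intro!: exec.intros exI)
next
  case Succ
  show ?case unfolding compile_correct_def
    by (auto elim!: computes_SuccE intro!: exec.intros exI)
next
  case (Proj i)
  show ?case unfolding compile_correct_def
    by (auto elim!: computes_ProjE intro!: exec.intros exI)
next
  case (Comp f gs)
  show ?case unfolding compile_correct_def
  proof (intro allI impI)
    fix as y out n and s :: "nat \<Rightarrow> nat"
    assume *: "computes (Comp f gs) (map s as) y" "\<forall>a\<in>set as. a < n" "out < n" "s 0 = 0"
    from *(1) obtain ys where ys: "list_all2 (\<lambda>g y. computes g (map s as) y) gs ys" "computes f ys y"
      by (rule computes_CompE)
    obtain t where t: "exec (compile_args gs as n (n + length gs)) s t"
      "\<forall>j<length gs. t (n + j) = ys ! j" "\<forall>r<n. t r = s r"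
      using exec_compile_args[OF _ ys(1) *(2) order_refl *(4)] Comp *(3) by auto
    have "map t [n..<n + length gs] = ys"
      using t(2) list_all2_lengthD[OF ys(1)] by (intro nth_equalityI) auto
    then obtain u where u: "exec (compile f [n..<n + length gs] out (n + length gs)) t u" "u out = y"
       "\<And>r. r < n + length gs \<Longrightarrow> r \<noteq> out \<Longrightarrow> u r = t r"
      by (rule compile_correctD[OF Comp(1) ys(2), of t "[n..<n + length gs]" "n + length gs" out]) (use *(3,4) t(3) in auto)
    show "\<exists>t. exec (compile (Comp f gs) as out n) s t \<and> t out = y \<and> (\<forall>r<n. r \<noteq> out \<longrightarrow> t r = s r)"
      using t u by (auto intro!: exI[of _ u] exec.intros)
  qed
next
  case (PrimRec f g)
  show ?case unfolding compile_correct_def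
  proof (intro allI impI)
    fix as y out n and s :: "nat \<Rightarrow> nat"
    assume *: "computes (PrimRec f g) (map s as) y" "\<forall>a\<in>set as. a < n" "out < n" "s 0 = 0"
    obtain a as' where as: "as = a # as'"
      using *(1) by (cases as) (auto elim: computes.cases)
    define k where "k = s a"
    define xs where "xs = map s as'"
    have y: "computes (PrimRec f g) (k # xs) y" using *(1) by (simp add: as k_def xs_def)
    then obtain ys where ys: "\<And>j. j \<le> k \<Longrightarrow> computes (PrimRec f g) (j # xs) (ys j)"
      using computes_PrimRec_chain[OF y] by metis
    have "computes f xs (ys 0)" using ys[of 0] by (auto elim: computes_PrimRec_0E)
    then obtain t where t: "exec (compile f as' (n+1) (n+4)) s t" "t (n+1) = ys 0"
      "\<And>r. r < n+4 \<Longrightarrow> r \<noteq> n+1 \<Longrightarrow> t r = s r"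
      using compile_correctD[OF PrimRec(1) _ xs_def[symmetric], of "ys 0" "n+4" "n+1"] * as
      by (auto simp: trans_less_add1)
    define u where "u = t(n := k, n+2 := 0)"
    have mu: "map u as' = xs" unfolding xs_def
    proof (rule map_cong[OF refl])
      fix x assume "x \<in> set as'"
      then have "x < n" using * as by auto
      then show "u x = s x" using t(3)[of x] by (simp add: u_def)
    qed
    have "\<exists>t. exec (While n
           (Seq (compile g ((n+2) # (n+1) # as') (n+3) (n+4))
           (Seq (Assign (n+1) (n+3) 0)
           (Seq (Assign (n+2) (n+2) 1)
                (Assign n n (- 1)))))) u t \<and> t (n+1) = ys k \<and> (\<forall>r<n. t r = u r)"
      using * as t mu by (intro exec_PrimRec_loop[OF PrimRec ys, of k 0]) (auto simp: u_def)
    then obtain t' where t': "exec (While n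
           (Seq (compile g ((n+2) # (n+1) # as') (n+3) (n+4))
           (Seq (Assign (n+1) (n+3) 0)
           (Seq (Assign (n+2) (n+2) 1)
                (Assign n n (- 1)))))) u t'" "t' (n+1) = ys k" "\<forall>r<n. t' r = u r" by blast
    have yk: "ys k = y" using ys[of k] y computes_functional by blast
    have a: "a < n" using * as by simp
    have k: "t a = k" using t(3)[of a] a by (simp add: k_def)
    have t0: "t 0 = 0" using t(3)[of 0] * by simp
    have "exec (compile (PrimRec f g) as out n) s (t'(out := y))"
      unfolding compile.simps as list.sel
      by (rule exec.Seq[OF t(1)], rule exec.Seq, rule exec.Assign[OF _ refl, of k], simp add: k,
          rule exec.Seq, rule exec.Assign[of 0, OF _ refl],
          use *(3) t0 in simp, rule exec.Seq, rule t'(1)[unfolded u_def],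
          rule exec.Assign[OF _ refl], simp only: t'(2) yk)
    moreover have "\<forall>r<n. r \<noteq> out \<longrightarrow> (t'(out := y)) r = s r" using t'(3) t(3) by (simp add: u_def)
    ultimately show "\<exists>t. exec (compile (PrimRec f g) as out n) s t \<and> t out = y \<and> (\<forall>r<n. r \<noteq> out \<longrightarrow> t r = s r)"
      by (intro exI[of _ "t'(out := y)"]) simp
  qed
next
  case (Mu f)
  show ?case unfolding compile_correct_def
  proof (intro allI impI)
    fix as k out n and s :: "nat \<Rightarrow> nat"
    assume *: "computes (Mu f) (map s as) k" "\<forall>a\<in>set as. a < n" "out < n" "s 0 = 0"
    define xs where "xs = map s as"
    from *(1) have k: "computes f (k # xs) 0" "\<forall>j<k. \<exists>y>0. computes f (j # xs) y"
      by (auto elim: computes_MuE simp: xs_def)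
    obtain y where y: "computes f (0 # xs) y" using k by (cases k) auto
    define u where "u = s(n := 0)"
    have mu: "map u as = xs" using * by (force simp: u_def xs_def)
    then obtain t where t: "exec (compile f (n # as) (n+1) (n+2)) u t" "t (n+1) = y"
      "\<And>r. r < n+2 \<Longrightarrow> r \<noteq> n+1 \<Longrightarrow> t r = u r"
      using compile_correctD[OF Mu y, of u "n # as" "n+2" "n+1"] * by (auto simp: u_def less_Suc_eq)
    have "map t as = xs" using * t(3) mu by force
    then obtain t' where t': "exec (While (n+1) (Seq (Assign n n 1) (compile f (n # as) (n+1) (n+2)))) t t'"
      "t' n = k" "\<forall>r<n. t' r = t r"
      using exec_Mu_loop[OF Mu k, of 0 t n as] * t(2) t(3)[of n] t(3)[of 0] y by (auto simp: u_def)
    have "exec (compile (Mu f) as out n) s (t'(out := k))"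
      unfolding compile.simps
      by (rule exec.Seq[OF exec.Assign[OF _ u_def]], use *(4) in simp, rule exec.Seq[OF t(1)],
          rule exec.Seq[OF t'(1)], rule exec.Assign[OF _ refl], use t'(2) in simp)
    moreover have "\<forall>r<n. r \<noteq> out \<longrightarrow> (t'(out := k)) r = s r" using t'(3) t(3) by (simp add: u_def)
    ultimately show "\<exists>t. exec (compile (Mu f) as out n) s t \<and> t out = k \<and> (\<forall>r<n. r \<noteq> out \<longrightarrow> t r = s r)"
      by (intro exI[of _ "t'(out := k)"]) simp
  qed
qed

section \<open>Register machines with jumps\<close>

datatype instr = Asg nat nat int nat | Test nat nat nat

text \<open>Each instruction is viewed as a simultaneous assignment to all registers, since the
  automaton resets every register clock once per round, also those whose register keeps its
  value.\<close>

fun source :: "instr \<Rightarrow> nat \<Rightarrow> nat" where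
  "source (Asg a b d q) i = (if i = a then b else i)"
| "source (Test r q q') i = i"

fun offset :: "instr \<Rightarrow> nat \<Rightarrow> int" where
  "offset (Asg a b d q) i = (if i = a then d else 0)"
| "offset (Test r q q') i = 0"

fun target :: "instr \<Rightarrow> (nat \<Rightarrow> nat) \<Rightarrow> nat" where
  "target (Asg a b d q) s = q"
| "target (Test r q q') s = (if s r = 0 then q else q')"

text \<open>An assignment with a negative result has no successor. The jump is determined by the new
  state because the automaton branches at the end of a round; a \<open>Test\<close> changes no
  register, so this is the usual meaning.\<close>

definition mstep :: "instr list \<Rightarrow> nat \<times> (nat \<Rightarrow> nat) \<Rightarrow> nat \<times> (nat \<Rightarrow> nat) \<Rightarrow> bool" where
  "mstep P = (\<lambda>(q, s) (q', s'). q < length P \<and>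
     (\<forall>i. int (s' i) = int (s (source (P ! q) i)) + offset (P ! q) i) \<and> q' = target (P ! q) s')"

lemma mstep_deterministic:
  assumes "mstep P c c'" "mstep P c c''"
  shows "c' = c''"
proof -
  have "int (snd c' i) = int (snd c'' i)" for i
    using assms by (simp add: mstep_def case_prod_beta)
  then have "snd c' = snd c''" by (simp add: fun_eq_iff)
  moreover have "fst c' = fst c''"
    using assms calculation by (simp add: mstep_def case_prod_beta)
  ultimately show ?thesis by (rule prod_eqI[rotated])
qed

text \<open>Jump targets are absolute, \<open>n\<close> being the address of the first instruction.
  The closing \<open>Test r n n\<close> is an unconditional jump back to the loop test.\<close>

fun code :: "nat \<Rightarrow> com \<Rightarrow> instr list" where
  "code n Skip = []"
| "code n (Assign a b d) = [Asg a b d (Suc n)]"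
| "code n (Seq c c') = code n c @ code (n + length (code n c)) c'"
| "code n (While r c) = Test r (n + length (code (Suc n) c) + 2) (Suc n) # code (Suc n) c @ [Test r n n]"

lemma mstep_Asg:
  assumes "q < length P" "P ! q = Asg a b d q'" "int k = int (s b) + d"
  shows "mstep P (q, s) (q', s(a := k))"
  using assms by (simp add: mstep_def)

lemma mstep_Test:
  assumes "q < length P" "P ! q = Test r q1 q2"
  shows "mstep P (q, s) (if s r = 0 then q1 else q2, s)"
  using assms by (simp add: mstep_def)

lemma exec_code:
  assumes "exec c s t" "P = us @ code n c @ vs" "length us = n"
  shows "(mstep P)\<^sup>*\<^sup>* (n, s) (n + length (code n c), t)"
  using assms
proof (induction arbitrary: us vs n rule: exec.induct)
  case (Skip s)
  then show ?case by simp
next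
  case (Assign k s b d t a)
  then show ?case by (auto intro!: r_into_rtranclp mstep_Asg[of _ _ a b d] simp: nth_append simp del: fun_upd_apply)
next
  case (Seq c s t c' u)
  have "(mstep P)\<^sup>*\<^sup>* (n, s) (n + length (code n c), t)"
    using Seq.prems by (intro Seq.IH(1)[of us _ "code (n + length (code n c)) c' @ vs"]) auto
  also have "(mstep P)\<^sup>*\<^sup>* \<dots> (n + length (code n c) + length (code (n + length (code n c)) c'), u)"
    using Seq.prems by (intro Seq.IH(2)[of "us @ code n c" _ vs]) auto
  finally show ?case by (simp add: add.assoc)
next
  case (While_False s r c)
  then show ?case using mstep_Test[of n P r _ _ s] by (auto simp: nth_append)
next
  case (While_True s r c t u)
  let ?B = "code (Suc n) c"
  have "mstep P (n, s) (Suc n, s)"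
    using While_True.prems While_True.hyps mstep_Test[of n P r _ _ s] by (auto simp: nth_append)
  also have "(mstep P)\<^sup>*\<^sup>* (Suc n, s) (Suc n + length ?B, t)"
    using While_True.prems by (intro While_True.IH(1)[of "us @ [_]" _ "Test r n n # vs"]) auto
  also have "mstep P (Suc n + length ?B, t) (n, t)"
    using While_True.prems mstep_Test[of "Suc n + length ?B" P r n n t] by (auto simp: nth_append)
  also have "(mstep P)\<^sup>*\<^sup>* (n, t) (n + length (code n (While r c)), u)"
    using While_True.prems by (intro While_True.IH(2)) auto
  finally show ?case .
qed

definition wf_instr :: "nat \<Rightarrow> instr \<Rightarrow> bool" where
  "wf_instr m ins \<longleftrightarrow> (case ins of
     Asg a b d q \<Rightarrow> 0 < a \<and> a \<le> m \<and> b \<le> m \<and> d \<le> 1 \<and> (a \<noteq> b \<longrightarrow> 0 \<le> d)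
   | Test r q q' \<Rightarrow> 0 < r \<and> r \<le> m)"

lemma wf_instr_mono: "wf_instr m ins \<Longrightarrow> m \<le> m' \<Longrightarrow> wf_instr m' ins"
  by (auto simp: wf_instr_def split: instr.splits)

lemma wf_code: "wf_com c \<Longrightarrow> \<exists>m. \<forall>ins\<in>set (code n c). wf_instr m ins"
proof (induction c arbitrary: n)
  case (Assign a b d)
  then show ?case by (intro exI[of _ "max a b"]) (auto simp: wf_instr_def)
next
  case (Seq c c')
  then obtain m m' where "\<forall>ins\<in>set (code n c). wf_instr m ins"
    "\<forall>ins\<in>set (code (n + length (code n c)) c'). wf_instr m' ins" by fastforce
  then show ?case by (intro exI[of _ "max m m'"]) (auto intro: wf_instr_mono)
next
  case (While r c)
  then obtain m where m: "\<forall>ins\<in>set (code (Suc n) c). wf_instr m ins" by fastforce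
  have "wf_instr (max m r) (Test r k l)" for k l using While.prems by (simp add: wf_instr_def)
  then show ?case using m by (intro exI[of _ "max m r"]) (auto intro: wf_instr_mono)
qed auto

section \<open>From register machines to timed automata\<close>

definition loc :: "nat \<Rightarrow> nat set \<Rightarrow> nat" where
  "loc q S = 5 + prod_encode (q, set_encode S)"

lemma loc_inject: "finite S \<Longrightarrow> finite S' \<Longrightarrow> loc q S = loc q' S' \<longleftrightarrow> q = q' \<and> S = S'"
  by (simp add: loc_def set_encode_eq)

lemma loc_neq [simp]: "loc q S \<noteq> 0" "loc q S \<noteq> Suc 0" "loc q S \<noteq> 2" "loc q S \<noteq> 3" "loc q S \<noteq> 4"
   "0 \<noteq> loc q S" "Suc 0 \<noteq> loc q S" "2 \<noteq> loc q S" "3 \<noteq> loc q S" "4 \<noteq> loc q S"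
  by (simp_all add: loc_def)

text \<open>The target of the initial edge needs a concrete number because \<open>init_code\<close>
  has to reproduce the code of that edge.\<close>

lemma loc_0_empty: "loc 0 {} = 5"
  by (simp add: loc_def prod_encode_def)

fun branches :: "instr \<Rightarrow> ((nat, nat) constr \<times> nat) set" where
  "branches (Asg a b d q) = {([], q)}"
| "branches (Test r q q') = {([ClockConst r Eq 0], q), ([ClockConst r Gt 0], q')}"

type_synonym nat_edge = "(nat, nat, nat, nat) edge"

text \<open>A register is the clock of the same number. The assignment of \<open>b + d\<close> to \<open>i\<close> is performed by resetting
  \<open>i\<close> when the clock \<open>b\<close> equals \<open>p - d\<close>, so that \<open>i\<close> equals \<open>b + d\<close> at time \<open>p\<close>. Register \<open>0\<close> is constantly zero,
  as its clock starts every instruction at zero. In \<open>loc q S\<close>, the clocks in \<open>S\<close> have already been reset.\<close>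

definition reset_edges :: "instr list \<Rightarrow> nat \<Rightarrow> nat_edge set" where
  "reset_edges P m =
     {(loc q S, [ClockParam (source (P ! q) i) Eq 0 (- offset (P ! q) i)], 0, {i}, loc q (insert i S)) | q S i.
        q < length P \<and> S \<subseteq> {1..m} \<and> i \<in> {1..m} \<and> i \<notin> S \<and> source (P ! q) i \<notin> S}"

text \<open>At time \<open>p\<close> all register clocks have been reset and show the new values, so
  tests can be read off the clocks. Resetting clock \<open>0\<close> starts the next round.\<close>

definition final_edges :: "instr list \<Rightarrow> nat \<Rightarrow> nat_edge set" where
  "final_edges P m =
     {(loc q {1..m}, ClockParam 0 Eq 0 0 # g, 0, {0}, loc q' {}) | q g q'.
        q < length P \<and> (g, q') \<in> branches (P ! q)}"

text \<open>Location \<open>0\<close> is initial and \<open>1\<close> is the sink; once \<open>2\<close> is reached, the letter may change from \<open>0\<close> to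
  \<open>1\<close> (in \<open>4\<close>) at any time. In \<open>3\<close>, clock \<open>1\<close> counts the letters emitted there.\<close>

definition control_edges :: "instr list \<Rightarrow> nat_edge set" where
  "control_edges P =
     {(0, [ParamConst 0 Eq 0], 0, {}, 2), (2, [], 0, {}, 2), (2, [], 1, {}, 4), (4, [], 1, {}, 4),
      (0, [], 0, {0, 1}, 3), (3, [ClockConst 0 Eq 1], 0, {0}, 3),
      (3, [ClockConst 0 Eq 0, ClockParam 1 Le 0 (- 1)], 1, {}, 4),
      (3, [ClockConst 0 Eq 0, ClockParam 1 Ge 0 1], 1, {}, 4),
      (loc (length P) {}, [], 0, {}, 2)}"

definition core_edges :: "instr list \<Rightarrow> nat \<Rightarrow> nat_edge set" where
  "core_edges P m = reset_edges P m \<union> final_edges P m \<union> control_edges P"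

text \<open>The sink edges start from all numbers below \<open>N\<close> except \<open>4\<close>.
  This includes \<open>1\<close>, which thereby loops, and \<open>N - 1\<close>, which forces the
  code of the edge set above \<open>N - 1\<close>.\<close>

definition base_edges :: "instr list \<Rightarrow> nat \<Rightarrow> nat \<Rightarrow> nat_edge set" where
  "base_edges P m N = core_edges P m \<union> {(l, [], 0, {}, 1) | l. l < N \<and> l \<noteq> 4}"

text \<open>Waiting until time \<open>X\<close> loads the input \<open>X\<close> into register
  \<open>1\<close>, and the resets set the other registers to zero. No other edge depends on
  \<open>X\<close>, so \<open>X\<close> can be chosen as the code of the others.\<close>

definition init_edge :: "nat \<Rightarrow> nat_edge" where
  "init_edge X = (0, [ClockConst 1 Eq (int X)], 0, {..<X} - {1}, loc 0 {})"

text \<open>With all numbers below \<open>X\<close> as locations and clocks, the codes of these sets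
  are \<open>2 ^ X - 1\<close>, computable from \<open>X\<close> alone.\<close>

definition machine_pta :: "instr list \<Rightarrow> nat \<Rightarrow> nat \<Rightarrow> nat \<Rightarrow> nat_pta" where
  "machine_pta P m N X =
     \<lparr>alphabet = {0, 1}, locs = {..<X}, init = 0, clocks = {..<X}, params = {0},
      invariant = (\<lambda>_. []), edges = insert (init_edge X) (base_edges P m N)\<rparr>"

lemma finite_core_edges: "finite (core_edges P m)"
proof -
  have "reset_edges P m \<subseteq> (\<lambda>(q, S, i). (loc q S, [ClockParam (source (P ! q) i) Eq 0 (- offset (P ! q) i)], 0, {i},
      loc q (insert i S))) ` ({..<length P} \<times> Pow {1..m} \<times> {1..m})"
    unfolding reset_edges_def by (intro subsetI, elim CollectE exE, rule_tac x = "(q, S, i)" in image_eqI) auto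
  then have "finite (reset_edges P m)" by (rule finite_subset) simp
  moreover have "final_edges P m \<subseteq> (\<Union>q<length P. (\<lambda>(g, q'). (loc q {1..m}, ClockParam 0 Eq 0 0 # g, 0, {0}, loc q' {}))
      ` branches (P ! q))"
    unfolding final_edges_def by (intro subsetI, elim CollectE exE, rule_tac a = q in UN_I) (auto intro: rev_image_eqI)
  then have "finite (final_edges P m)"
  proof (rule finite_subset)
    have "finite (branches ins)" for ins by (cases ins) auto
    then show "finite (\<Union>q<length P. (\<lambda>(g, q'). (loc q {1..m}, ClockParam 0 Eq 0 0 # g, 0::nat, {0::nat}, loc q' {}))
      ` branches (P ! q))" by blast
  qed
  moreover have "finite (control_edges P)" by (simp add: control_edges_def)
  ultimately show ?thesis by (simp add: core_edges_def)
qed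

lemma finite_base_edges: "finite (base_edges P m N)"
  by (simp add: base_edges_def finite_core_edges)

text \<open>The guard on clock \<open>1\<close> tells this edge from the others leaving location
  \<open>0\<close>. Adding it therefore adds exactly one power of two to the code of the edge
  set.\<close>

lemma init_edge_notin: "init_edge X \<notin> base_edges P m N"
  by (auto simp: init_edge_def base_edges_def core_edges_def reset_edges_def final_edges_def control_edges_def)

section \<open>Transitions of the automaton and the shape of its language\<close>

locale machine =
  fixes P :: "instr list" and m N X :: nat and T :: "real set"
  assumes wf: "\<And>q. q < length P \<Longrightarrow> wf_instr m (P ! q)"
    and core_locs: "\<And>l g a R l'. (l, g, a, R, l') \<in> core_edges P m \<Longrightarrow> l < N \<and> l' < N"
    and bounds: "1 \<le> m" "m < N" "5 < N" "N \<le> X"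
    and time: "T = {0..} \<or> T = \<nat>"
begin

abbreviation "A \<equiv> machine_pta P m N X"

abbreviation "s0 \<equiv> (\<lambda>r. if r = 1 then X else 0)"

lemma T_simps [simp]: "0 \<in> T" "1 \<in> T" "real n \<in> T"
  using time by auto

lemma T_add: "x \<in> T \<Longrightarrow> y \<in> T \<Longrightarrow> x + y \<in> T"
  using time by auto

lemma T_nonneg: "x \<in> T \<Longrightarrow> 0 \<le> x"
  using time by (auto elim: Nats_cases)

lemma edges_A: "edges A = insert (init_edge X) (base_edges P m N)"
  by (simp add: machine_pta_def)

lemma edge_locs:
  assumes "(l, g, a, R, l') \<in> edges A"
  shows "l < X" "l' < X" "l' < N"
  using assms bounds core_locs[of l g a R l']
  by (auto simp: edges_A base_edges_def init_edge_def loc_0_empty)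

lemma source_le: "q < length P \<Longrightarrow> i \<le> m \<Longrightarrow> source (P ! q) i \<le> m"
  using wf[of q] by (cases "P ! q") (auto simp: wf_instr_def)

lemma is_pta_A: "is_pta A"
proof -
  have edge: "constr_over {..<X} {0} g \<and> a \<in> {0, 1} \<and> R \<subseteq> {..<X}" if e: "(l, g, a, R, l') \<in> edges A" for l g a R l'
  proof -
    consider "(l, g, a, R, l') \<in> reset_edges P m" | "(l, g, a, R, l') \<in> final_edges P m"
      | "(l, g, a, R, l') \<in> insert (init_edge X) (control_edges P)" | "g = []" "a = 0" "R = {}"
      using e by (auto simp: edges_A base_edges_def core_edges_def)
    then show ?thesis
    proof cases
      case 1
      then obtain q i where "q < length P" "i \<in> {1..m}" "a = 0" "R = {i}"
        "g = [ClockParam (source (P ! q) i) Eq 0 (- offset (P ! q) i)]"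
        by (auto simp: reset_edges_def)
      then show ?thesis using source_le[of q i] bounds by (simp add: constr_over_def)
    next
      case 2
      then obtain q g' q' where "q < length P" "(g', q') \<in> branches (P ! q)" "a = 0" "R = {0}"
        "g = ClockParam 0 Eq 0 0 # g'"
        by (auto simp: final_edges_def)
      then show ?thesis using wf[of q] bounds by (cases "P ! q") (auto simp: wf_instr_def constr_over_def)
    next
      case 3
      then show ?thesis using bounds by (auto simp: init_edge_def control_edges_def constr_over_def)
    qed (simp add: constr_over_def)
  qed
  have "\<forall>(l, g, a, R, l')\<in>edges A. l \<in> locs A \<and> constr_over (clocks A) (params A) g \<and>
      a \<in> alphabet A \<and> R \<subseteq> clocks A \<and> l' \<in> locs A"
  proof (intro ballI, clarify)
    fix l g a R l' assume e: "(l, g, a, R, l') \<in> edges A"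
    from edge[OF e] edge_locs[OF e]
    show "l \<in> locs A \<and> constr_over (clocks A) (params A) g \<and> a \<in> alphabet A \<and> R \<subseteq> clocks A \<and> l' \<in> locs A"
      by (simp add: machine_pta_def)
  qed
  moreover have "finite (edges A)" by (simp add: edges_A finite_base_edges)
  ultimately show ?thesis
    unfolding is_pta_def using bounds by (simp add: machine_pta_def constr_over_def)
qed

text \<open>A step with delay and edge forgotten. Invariants are trivial and edges stay within the
  locations, so membership of the clock values in \<open>T\<close> is all that remains of
  \<open>is_config\<close>; it passes to \<open>w'\<close> as \<open>T\<close> is closed under
  addition.\<close>

definition tr :: "(nat \<Rightarrow> rat) \<Rightarrow> nat \<times> (nat \<Rightarrow> real) \<Rightarrow> nat \<Rightarrow> nat \<times> (nat \<Rightarrow> real) \<Rightarrow> bool" where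
  "tr v = (\<lambda>(l, w) a (l', w'). \<exists>d g R. d \<in> T \<and> (\<forall>x. w x \<in> T) \<and> (l, g, a, R, l') \<in> edges A \<and>
     sat v (\<lambda>x. w x + d) g \<and> w' = (\<lambda>x. if x \<in> R then 0 else w x + d))"

lemma trI:
  assumes "(l, g, a, R, l') \<in> edges A" "d \<in> T" "\<And>x. w x \<in> T" "sat v (\<lambda>x. w x + d) g"
    "w' = (\<lambda>x. if x \<in> R then 0 else w x + d)"
  shows "tr v (l, w) a (l', w')"
  using assms unfolding tr_def prod.case by blast

lemma trE:
  assumes "tr v (l, w) a (l', w')"
  obtains d g R where "(l, g, a, R, l') \<in> edges A" "d \<in> T" "\<And>x. w x \<in> T" "\<And>x. w' x \<in> T"
    "sat v (\<lambda>x. w x + d) g" "w' = (\<lambda>x. if x \<in> R then 0 else w x + d)"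
  using assms T_add unfolding tr_def by force

lemma tr_step: "tr v c a c' \<longleftrightarrow> (\<exists>d e. step T A v c d e c' \<and> action e = a)"
proof (cases c; cases c')
  fix l w l' w' assume [simp]: "c = (l, w)" "c' = (l', w')"
  have inv: "invariant A k = []" "locs A = {..<X}" for k by (simp_all add: machine_pta_def)
  show ?thesis
  proof
    assume "tr v c a c'"
    then obtain d g R where *: "(l, g, a, R, l') \<in> edges A" "d \<in> T" "\<And>x. w x \<in> T" "\<And>x. w' x \<in> T"
      "sat v (\<lambda>x. w x + d) g" "w' = (\<lambda>x. if x \<in> R then 0 else w x + d)"
      by (auto elim: trE)
    then have "step T A v c d (l, g, a, R, l') c'"
      using edge_locs[OF *(1)] T_nonneg[OF *(2)] by (simp add: step_def is_config_def inv sat_def)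
    then show "\<exists>d e. step T A v c d e c' \<and> action e = a"
      by (intro exI[of _ d] exI[of _ "(l, g, a, R, l')"]) (simp add: action_def)
  next
    assume "\<exists>d e. step T A v c d e c' \<and> action e = a"
    then show "tr v c a c'" unfolding step_def tr_def is_config_def action_def by auto
  qed
qed

lemma Inf_in_language:
  "Inf \<alpha> \<in> untimed_language T A v \<longleftrightarrow>
     (\<exists>c. c 0 = (0, \<lambda>_. 0) \<and> (\<forall>i. tr v (c i) (\<alpha> i) (c (Suc i))))"
proof -
  have init: "init_config A = (0, \<lambda>_. 0)" "is_config T A v (0, \<lambda>_. 0)"
    using bounds by (auto simp: init_config_def is_config_def machine_pta_def sat_def)
  have run: "infinite_run T A v c d e \<longleftrightarrow> c 0 = (0, \<lambda>_. 0) \<and> (\<forall>i. step T A v (c i) (d i) (e i) (c (Suc i)))"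
    for c d e using init by (auto simp: infinite_run_def)
  have "Inf \<alpha> \<in> untimed_language T A v \<longleftrightarrow> (\<exists>c d e. \<alpha> = action \<circ> e \<and> infinite_run T A v c d e)"
    by (auto simp: untimed_language_def)
  also have "\<dots> \<longleftrightarrow>
     (\<exists>c d e. c 0 = (0, \<lambda>_. 0) \<and> (\<forall>i. step T A v (c i) (d i) (e i) (c (Suc i)) \<and> action (e i) = \<alpha> i))"
    unfolding run fun_eq_iff o_apply by metis
  also have "\<dots> \<longleftrightarrow> (\<exists>c. c 0 = (0, \<lambda>_. 0) \<and> (\<forall>i. \<exists>d e. step T A v (c i) d e (c (Suc i)) \<and> action e = \<alpha> i))"
    by metis
  finally show ?thesis by (simp add: tr_step)
qed

text \<open>This determines the shape of all words: \<open>1\<close> cannot come first, and the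
  first \<open>1\<close> leads to location \<open>4\<close>, which only allows \<open>1\<close> from
  then on.\<close>

lemma edge_letter:
  "(l, g, a, R, l') \<in> edges A \<Longrightarrow> (a = 0 \<and> l \<noteq> 4 \<and> l' \<noteq> 4) \<or> (a = 1 \<and> l \<noteq> 0 \<and> l' = 4)"
  by (auto simp: edges_A base_edges_def core_edges_def reset_edges_def final_edges_def control_edges_def init_edge_def)

lemma tr_letter:
  "tr v c a c' \<Longrightarrow> (a = 0 \<and> fst c \<noteq> 4 \<and> fst c' \<noteq> 4) \<or> (a = 1 \<and> fst c \<noteq> 0 \<and> fst c' = 4)"
  by (cases c; cases c') (auto elim!: trE dest: edge_letter)

lemma edge_loop4: "(4, [], 1, {}, 4) \<in> edges A"
  by (simp add: edges_A base_edges_def core_edges_def control_edges_def)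

lemma edge_sink: "l < N \<Longrightarrow> l \<noteq> 4 \<Longrightarrow> (l, [], 0, {}, 1) \<in> edges A"
  by (simp add: edges_A base_edges_def)

lemma no_deadlock:
  assumes "l < N" "\<And>x. w x \<in> T"
  shows "\<exists>a c'. tr v (l, w) a c'"
proof (cases "l = 4")
  case True
  have "tr v (4, w) 1 (4, w)"
    using assms(2) by (intro trI[OF edge_loop4 T_simps(1)]) (auto simp: sat_def)
  with True show ?thesis by blast
next
  case False
  then have "tr v (l, w) 0 (1, w)"
    using assms by (intro trI[OF edge_sink T_simps(1)]) (auto simp: sat_def)
  then show ?thesis by blast
qed

lemma Fin_notin_language: "Fin u \<notin> untimed_language T A v"
proof
  assume "Fin u \<in> untimed_language T A v"
  then obtain n c d e where "finite_run T A v n c d e" by (auto simp: untimed_language_def)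
  then have c: "c 0 = init_config A" "\<And>i. i < n \<Longrightarrow> step T A v (c i) (d i) (e i) (c (Suc i))"
    "\<not> (\<exists>d' e' c'. step T A v (c n) d' e' c')"
    by (auto simp: finite_run_def)
  have "fst (c n) < N \<and> (\<forall>x. snd (c n) x \<in> T)"
  proof (cases n)
    case 0
    then show ?thesis using c(1) bounds by (simp add: init_config_def machine_pta_def)
  next
    case (Suc i)
    then have "tr v (c i) (action (e i)) (c n)" using c(2)[of i] unfolding tr_step by blast
    then show ?thesis by (cases "c i"; cases "c n") (auto elim!: trE simp: edge_locs)
  qed
  then obtain a c' where "tr v (c n) a c'" using no_deadlock[of "fst (c n)" "snd (c n)" v] by auto
  then show False using c(3) unfolding tr_step by blast
qed

text \<open>There are \<open>n + 1\<close> zeros, so that \<open>n\<close> counts the zeros after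
  the edge leaving the initial location; in the branch through location \<open>3\<close> it is the
  number of ticks.\<close>

definition ab :: "nat \<Rightarrow> nat \<Rightarrow> nat" where
  "ab n i = (if i \<le> n then 0 else 1)"

lemma language_subset: "untimed_language T A v \<subseteq> insert (Inf (\<lambda>_. 0)) (range (\<lambda>n. Inf (ab n)))"
proof
  fix x assume x: "x \<in> untimed_language T A v"
  then obtain \<alpha> where \<alpha>: "x = Inf \<alpha>" using Fin_notin_language by (cases x) auto
  with x obtain c where c: "c 0 = (0, \<lambda>_. 0)" "\<And>i. tr v (c i) (\<alpha> i) (c (Suc i))"
    by (auto simp: Inf_in_language)
  note l = tr_letter[OF c(2)]
  show "x \<in> insert (Inf (\<lambda>_. 0)) (range (\<lambda>n. Inf (ab n)))"
  proof (cases "\<forall>i. \<alpha> i = 0")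
    case True
    then show ?thesis using \<alpha> by (auto simp: fun_eq_iff)
  next
    case False
    define k where "k = (LEAST i. \<alpha> i \<noteq> 0)"
    have k: "\<alpha> k \<noteq> 0" using False unfolding k_def by (auto intro: LeastI)
    have less: "\<alpha> i = 0" if "i < k" for i using that not_less_Least unfolding k_def by blast
    have "k \<noteq> 0" using k l[of 0] c(1) by (cases "k = 0") auto
    then obtain n where n: "k = Suc n" by (cases k) auto
    have 4: "fst (c (Suc (k + j))) = 4" for j
    proof (induction j)
      case 0
      then show ?case using l[of k] k by auto
    next
      case (Suc j)
      then show ?case using l[of "Suc (k + j)"] by auto
    qed
    have "\<alpha> i = ab n i" for i
    proof (cases "i < k")
      case True
      then show ?thesis using less n by (simp add: ab_def)
    next
      case False
      then show ?thesis using 4[of "i - k"] l[of i] n by (auto simp: ab_def)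
    qed
    then have "\<alpha> = ab n" by blast
    then show ?thesis using \<alpha> by blast
  qed
qed

lemma zeros_in_language: "Inf (\<lambda>_. 0) \<in> untimed_language T A v"
proof -
  have "tr v (if i = 0 then 0 else 1, \<lambda>_. 0) 0 (1, \<lambda>_. 0)" for i :: nat
    using bounds by (intro trI[OF edge_sink T_simps(1)]) (auto simp: sat_def)
  then show ?thesis unfolding Inf_in_language
    by (intro exI[of _ "\<lambda>i. (if i = 0 then 0 else 1, \<lambda>_. 0)"]) (simp add: fun_eq_iff)
qed

abbreviation tr0 :: "(nat \<Rightarrow> rat) \<Rightarrow> nat \<times> (nat \<Rightarrow> real) \<Rightarrow> nat \<times> (nat \<Rightarrow> real) \<Rightarrow> bool" where
  "tr0 v c c' \<equiv> tr v c 0 c'"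

lemma ab_in_language:
  assumes "(tr0 v ^^ Suc n) (0, \<lambda>_. 0) c" "tr v c 1 c'"
  shows "Inf (ab n) \<in> untimed_language T A v"
proof -
  obtain f where f: "f 0 = (0, \<lambda>_. 0)" "f (Suc n) = c" "\<And>i. i < Suc n \<Longrightarrow> tr0 v (f i) (f (Suc i))"
    using assms(1) unfolding relpowp_fun_conv by blast
  obtain l' w' where c': "c' = (l', w')" by (cases c')
  have l': "l' = 4" using tr_letter[OF assms(2)] c' by simp
  have "\<And>x. w' x \<in> T" using assms(2) c' by (cases c) (auto elim!: trE)
  then have loop: "tr v c' 1 c'" unfolding c' l'
    by (intro trI[OF edge_loop4 T_simps(1)]) (auto simp: sat_def)
  show ?thesis unfolding Inf_in_language
    using f assms(2) loop
    by (intro exI[of _ "\<lambda>i. if i \<le> Suc n then f i else c'"]) (auto simp: ab_def le_less not_less less_Suc_eq)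
qed

text \<open>Once location \<open>2\<close> is reached after \<open>k\<close> zeros, its loop
  supplies the remaining \<open>Suc n - k\<close> ones of the \<open>n + 1\<close> zeros.\<close>

lemma ab_in_languageI:
  assumes "(tr0 v ^^ k) (0, \<lambda>_. 0) (2, w)" "k \<le> Suc n" "0 < k"
  shows "Inf (ab n) \<in> untimed_language T A v"
proof -
  have edge: "(2, [], 0, {}, 2) \<in> edges A" "(2, [], 1, {}, 4) \<in> edges A"
    by (simp_all add: edges_A base_edges_def core_edges_def control_edges_def)
  have w: "w x \<in> T" for x
    using assms(1,3) by (cases k) (auto elim!: trE)
  have loop: "tr0 v (2, w) (2, w)"
    using w by (intro trI[OF edge(1) T_simps(1)]) (auto simp: sat_def)
  have "(tr0 v ^^ i) (2, w) (2, w)" for i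
    using loop by (induction i) auto
  then have "(tr0 v ^^ (k + (Suc n - k))) (0, \<lambda>_. 0) (2, w)"
    using assms(1) unfolding relpowp_add by blast
  then have "(tr0 v ^^ Suc n) (0, \<lambda>_. 0) (2, w)"
    using assms(2) by (simp del: relpowp.simps)
  moreover have "tr v (2, w) 1 (4, w)"
    using w by (intro trI[OF edge(2) T_simps(1)]) (auto simp: sat_def)
  ultimately show ?thesis by (rule ab_in_language)
qed

lemma language_zero:
  assumes "v 0 = 0"
  shows "Inf (ab n) \<in> untimed_language T A v"
proof (rule ab_in_languageI)
  have "tr0 v (0, \<lambda>_. 0) (2, \<lambda>_. 0)"
    by (rule trI[of _ "[ParamConst 0 Eq 0]" _ "{}", OF _ T_simps(1)])
      (auto simp: edges_A base_edges_def core_edges_def control_edges_def sat_def assms)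
  then show "(tr0 v ^^ 1) (0, \<lambda>_. 0) (2, \<lambda>_. 0)" by auto
qed auto

lemma ticks_in_language:
  assumes "real n \<le> of_rat (v 0) - 1 \<or> of_rat (v 0) + 1 \<le> real n"
  shows "Inf (ab n) \<in> untimed_language T A v"
proof -
  have edge: "(0, [], 0, {0, 1}, 3) \<in> edges A" "(3, [ClockConst 0 Eq 1], 0, {0}, 3) \<in> edges A"
      "(3, [ClockConst 0 Eq 0, ClockParam 1 Le 0 (- 1)], 1, {}, 4) \<in> edges A"
      "(3, [ClockConst 0 Eq 0, ClockParam 1 Ge 0 1], 1, {}, 4) \<in> edges A"
    by (simp_all add: edges_A base_edges_def core_edges_def control_edges_def)
  define w where "w j = (\<lambda>x::nat. if x = 0 then 0 else real j)" for j
  have path: "(tr0 v ^^ Suc j) (0, \<lambda>_. 0) (3, w j)" for j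
  proof (induction j)
    case 0
    have "tr0 v (0, \<lambda>_. 0) (3, w 0)"
      by (rule trI[OF edge(1) T_simps(1)]) (auto simp: sat_def w_def)
    then show ?case by auto
  next
    case (Suc j)
    have "tr0 v (3, w j) (3, w (Suc j))"
      by (rule trI[OF edge(2) T_simps(2)]) (auto simp: sat_def w_def)
    with Suc show ?case by (auto intro: relpowp_Suc_I)
  qed
  have "tr v (3, w n) 1 (4, w n)"
    using assms
  proof
    assume "real n \<le> of_rat (v 0) - 1"
    then show ?thesis by (intro trI[OF edge(3) T_simps(1)]) (auto simp: sat_def w_def)
  next
    assume "of_rat (v 0) + 1 \<le> real n"
    then show ?thesis by (intro trI[OF edge(4) T_simps(1)]) (auto simp: sat_def w_def)
  qed
  with path show ?thesis by (rule ab_in_language)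
qed

section \<open>Soundness of the simulation\<close>

definition halts :: bool where
  "halts \<longleftrightarrow> (\<exists>s. (mstep P)\<^sup>*\<^sup>* (0, s0) (length P, s))"

text \<open>Clock \<open>0\<close> is the time since the start of the round. Relative to it, the clock of a register holds the
  old value before its reset and the new value minus \<open>p\<close> after it.\<close>

definition simulates :: "real \<Rightarrow> nat \<Rightarrow> nat set \<Rightarrow> (nat \<Rightarrow> nat) \<Rightarrow> (nat \<Rightarrow> real) \<Rightarrow> bool" where
  "simulates p q S s w \<longleftrightarrow> s 0 = 0 \<and> (\<forall>r\<in>{1..m}. w r = w 0 + (if r \<in> S
      then real (s (source (P ! q) r)) + real_of_int (offset (P ! q) r) - p else real (s r)))"

lemma simulates_unreset:
  assumes "simulates p q S s w" "r \<le> m" "r \<notin> S"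
  shows "w r = w 0 + real (s r)"
  using assms by (cases "r = 0") (auto simp: simulates_def)

text \<open>What can hold after \<open>k + 1\<close> zeros if \<open>p\<close> is positive. The
  disjunct \<open>halts\<close> makes the invariant conditional: without halting, location
  \<open>2\<close> is out of reach and the only source of the letter \<open>1\<close> is location
  \<open>3\<close>, with clock \<open>1\<close> showing the \<open>k\<close> ticks.\<close>

definition sim_inv :: "real \<Rightarrow> nat \<Rightarrow> nat \<times> (nat \<Rightarrow> real) \<Rightarrow> bool" where
  "sim_inv p k = (\<lambda>(l, w). halts \<or> l = 1 \<or> (l = 3 \<and> w 0 = 0 \<and> w 1 = real k) \<or>
     (\<exists>q S s. l = loc q S \<and> S \<subseteq> {1..m} \<and> (mstep P)\<^sup>*\<^sup>* (0, s0) (q, s) \<and> simulates p q S s w))"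

lemma offset_0: "q < length P \<Longrightarrow> source (P ! q) 0 = 0 \<and> offset (P ! q) 0 = 0"
  using wf[of q] by (cases "P ! q") (auto simp: wf_instr_def)

lemma source_gt: "q < length P \<Longrightarrow> m < i \<Longrightarrow> source (P ! q) i = i \<and> offset (P ! q) i = 0"
  using wf[of q] by (cases "P ! q") (auto simp: wf_instr_def)

lemma sim_inv_init:
  assumes "tr0 v (0, \<lambda>_. 0) c" "0 < v 0"
  shows "sim_inv p 0 c"
proof -
  obtain l w where c: "c = (l, w)" by (cases c)
  from assms(1) obtain d g R where e: "(0, g, 0, R, l) \<in> edges A"
    and "sat v (\<lambda>x. 0 + d) g" "w = (\<lambda>x. if x \<in> R then 0 else 0 + d)"
    unfolding c by (rule trE)
  then have g: "sat v (\<lambda>x. d) g" and w: "w = (\<lambda>x. if x \<in> R then 0 else d)" by (simp_all add: fun_eq_iff)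
  consider "g = [ParamConst 0 Eq 0]" | "l = 3" "R = {0, 1}" | "l = 1"
    | "g = [ClockConst 1 Eq (int X)]" "R = {..<X} - {1}" "l = loc 0 {}"
    using e by (auto simp: edges_A base_edges_def core_edges_def reset_edges_def final_edges_def
        control_edges_def init_edge_def)
  then show ?thesis
  proof cases
    case 1
    then show ?thesis using g assms(2) by (simp add: sat_def)
  next
    case 4
    then have "w r = s0 r" if "r \<le> m" for r using g w bounds that by (simp add: sat_def)
    then have "simulates p 0 {} s0 w" by (simp add: simulates_def)
    then show ?thesis using 4 unfolding c sim_inv_def by blast
  qed (simp_all add: c sim_inv_def w)
qed

text \<open>A reset edge is taken when the source clock equals \<open>p\<close> minus the offset.
  Clock \<open>0\<close> is then \<open>p\<close> minus the new value, so relative to it the reset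
  clock holds the new value minus \<open>p\<close>; at time \<open>p\<close> it shows the new value.
  Here \<open>p\<close> need not be an integer.\<close>

lemma sim_inv_step:
  assumes "sim_inv (of_rat (v 0)) k c" "tr0 v c c'"
  shows "sim_inv (of_rat (v 0)) (Suc k) c'"
proof (cases halts)
  case True
  then show ?thesis by (cases c') (simp add: sim_inv_def)
next
  case nh: False
  let ?p = "of_rat (v 0) :: real"
  obtain l w l' w' where c: "c = (l, w)" "c' = (l', w')" by (cases c, cases c')
  from assms(2) obtain d g R where e: "(l, g, 0, R, l') \<in> edges A"
    and T: "\<And>x. w x \<in> T" "\<And>x. w' x \<in> T"
    and g: "sat v (\<lambda>x. w x + d) g" and w': "w' = (\<lambda>x. if x \<in> R then 0 else w x + d)"
    unfolding c by (rule trE) blast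
  from assms(1) nh consider "l = 1" | "l = 3" "w 0 = 0" "w 1 = real k"
    | q S s where "l = loc q S" "S \<subseteq> {1..m}" "(mstep P)\<^sup>*\<^sup>* (0, s0) (q, s)" "simulates ?p q S s w"
    unfolding c sim_inv_def by auto
  then show ?thesis
  proof cases
    case 1
    then have "l' = 1" using e
      by (auto simp: edges_A base_edges_def core_edges_def reset_edges_def final_edges_def
          control_edges_def init_edge_def)
    then show ?thesis by (simp add: c sim_inv_def)
  next
    case 2
    have "l' = 1 \<or> (l' = 3 \<and> R = {0} \<and> g = [ClockConst 0 Eq 1])" using e 2(1)
      by (auto simp: edges_A base_edges_def core_edges_def reset_edges_def final_edges_def
          control_edges_def init_edge_def)
    then show ?thesis using 2 g by (auto simp: c sim_inv_def w' sat_def)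
  next
    case (3 q S s)
    have fin: "finite S" using 3(2) finite_subset by blast
    consider "l' = 1" | "S = {}" "q = length P"
      | i where "q < length P" "i \<in> {1..m}" "i \<notin> S" "source (P ! q) i \<notin> S" "R = {i}" "l' = loc q (insert i S)"
        "g = [ClockParam (source (P ! q) i) Eq 0 (- offset (P ! q) i)]"
      | g' q' where "q < length P" "S = {1..m}" "R = {0}" "l' = loc q' {}" "(g', q') \<in> branches (P ! q)"
        "g = ClockParam 0 Eq 0 0 # g'"
    proof -
      have "(l, g, 0, R, l') \<in> reset_edges P m \<or> (l, g, 0, R, l') \<in> final_edges P m \<or> l' = 1 \<or>
        (S = {} \<and> q = length P)"
        using e 3(1) fin by (auto simp: edges_A base_edges_def core_edges_def control_edges_def init_edge_def loc_inject)
      then show thesis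
      proof (elim disjE)
        assume "(l, g, 0, R, l') \<in> reset_edges P m"
        then obtain q2 S2 i where *: "l = loc q2 S2" "q2 < length P" "S2 \<subseteq> {1..m}" "i \<in> {1..m}" "i \<notin> S2"
          "source (P ! q2) i \<notin> S2" "R = {i}" "l' = loc q2 (insert i S2)"
          "g = [ClockParam (source (P ! q2) i) Eq 0 (- offset (P ! q2) i)]"
          by (auto simp: reset_edges_def)
        then have "q2 = q" "S2 = S" using fin 3(1) finite_subset[of S2 "{1..m}"] by (simp_all add: loc_inject)
        with * show thesis using that(3) by blast
      next
        assume "(l, g, 0, R, l') \<in> final_edges P m"
        then obtain q2 g' q' where *: "l = loc q2 {1..m}" "q2 < length P" "R = {0}" "l' = loc q' {}"
          "(g', q') \<in> branches (P ! q2)" "g = ClockParam 0 Eq 0 0 # g'"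
          by (auto simp: final_edges_def)
        then have "q2 = q" "S = {1..m}" using fin 3(1) by (simp_all add: loc_inject)
        with * show thesis using that(4) by blast
      qed (use that in blast)+
    qed
    then show ?thesis
    proof cases
      case 1
      then show ?thesis by (simp add: c sim_inv_def)
    next
      case 2
      then have halts using 3(3) unfolding halts_def by blast
      with nh show ?thesis by simp
    next
      case (3 i)
      note sim = \<open>simulates ?p q S s w\<close>
      have "w (source (P ! q) i) = w 0 + real (s (source (P ! q) i))"
        using simulates_unreset[OF sim source_le[OF 3(1)] 3(4)] 3(2) by simp
      then have "simulates ?p q (insert i S) s w'"
        using sim 3(2) g unfolding simulates_def w' 3(5,7) by (simp add: sat_def)
      then show ?thesis using 3(2,6) \<open>S \<subseteq> {1..m}\<close> \<open>(mstep P)\<^sup>*\<^sup>* (0, s0) (q, s)\<close>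
        unfolding c sim_inv_def by blast
    next
      case (4 g' q')
      note sim = \<open>simulates ?p q S s w\<close>
      \<comment> \<open>The conversion by \<open>nat\<close> truncates nothing: each new value is
        shown by a clock at the end of the round and is therefore nonnegative.\<close>
      define s' where "s' r = nat (int (s (source (P ! q) r)) + offset (P ! q) r)" for r
      have p: "w 0 + d = ?p" using g 4(6) by (simp add: sat_def)
      have val: "w r + d = real_of_int (int (s (source (P ! q) r)) + offset (P ! q) r)" if "r \<in> {1..m}" for r
        using sim 4(2) p that by (simp add: simulates_def)
      have int_s': "int (s' r) = int (s (source (P ! q) r)) + offset (P ! q) r" for r
      proof (cases "r \<in> {1..m}")
        case True
        then have "w' r = real_of_int (int (s (source (P ! q) r)) + offset (P ! q) r)"
          using val by (simp add: w' 4(3))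
        then have "0 \<le> int (s (source (P ! q) r)) + offset (P ! q) r" using T_nonneg[OF T(2)[of r]] by simp
        then show ?thesis by (simp add: s'_def)
      next
        case False
        then show ?thesis using offset_0[OF 4(1)] source_gt[OF 4(1), of r] by (cases "r = 0") (auto simp: s'_def)
      qed
      have val': "w r + d = real (s' r)" if "r \<in> {1..m}" for r
        using val[OF that] int_s'[of r] by (metis of_int_of_nat_eq)
      have "q' = target (P ! q) s'"
        using 4(1,5,6) g val' wf[of q] by (cases "P ! q") (auto simp: sat_def wf_instr_def)
      then have "mstep P (q, s) (q', s')" using 4(1) int_s' by (simp add: mstep_def)
      then have "(mstep P)\<^sup>*\<^sup>* (0, s0) (q', s')" using \<open>(mstep P)\<^sup>*\<^sup>* (0, s0) (q, s)\<close> by simp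
      moreover have "simulates ?p q' {} s' w'"
      proof -
        have "s' 0 = 0" using sim offset_0[OF 4(1)] by (simp add: s'_def simulates_def)
        then show ?thesis using val' by (simp add: simulates_def w' 4(3))
      qed
      ultimately show ?thesis using 4(4) unfolding c sim_inv_def by blast
    qed
  qed
qed

text \<open>The letter \<open>1\<close> after \<open>n + 1\<close> zeros comes from location
  \<open>2\<close>, \<open>3\<close> or \<open>4\<close>. In \<open>3\<close> the guards force a
  zero delay and compare clock \<open>1\<close>, which is \<open>n\<close>, with
  \<open>p - 1\<close> or \<open>p + 1\<close>, which fails for \<open>n\<close> this close to
  \<open>p\<close>. By the invariant, the other two locations require halting.\<close>

lemma halts_if_ab_in_language:
  assumes "Inf (ab n) \<in> untimed_language T A v" "0 < v 0"
    "of_rat (v 0) - 1 < real n" "real n < of_rat (v 0) + 1"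
  shows halts
proof -
  let ?p = "of_rat (v 0) :: real"
  obtain c where c: "c 0 = (0, \<lambda>_. 0)" "\<And>i. tr v (c i) (ab n i) (c (Suc i))"
    using assms(1) by (auto simp: Inf_in_language)
  have "sim_inv ?p k (c (Suc k))" if "k \<le> n" for k
    using that
  proof (induction k)
    case 0
    show ?case using c(2)[of 0] assms(2) by (intro sim_inv_init) (auto simp: c(1) ab_def)
  next
    case (Suc k)
    then show ?case using c(2)[of "Suc k"] by (intro sim_inv_step) (auto simp: ab_def)
  qed
  then have inv: "sim_inv ?p n (c (Suc n))" by simp
  obtain l w l' w' where l: "c (Suc n) = (l, w)" "c (Suc (Suc n)) = (l', w')"
    by (cases "c (Suc n)", cases "c (Suc (Suc n))")
  then have "tr v (l, w) 1 (l', w')" using c(2)[of "Suc n"] by (simp add: ab_def)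
  then obtain d g R where e: "(l, g, 1, R, l') \<in> edges A" "sat v (\<lambda>x. w x + d) g"
    by (auto elim: trE)
  from e(1) have "l = 2 \<or> l = 4 \<or> (l = 3 \<and> (g = [ClockConst 0 Eq 0, ClockParam 1 Le 0 (- 1)] \<or>
      g = [ClockConst 0 Eq 0, ClockParam 1 Ge 0 1]))"
    by (auto simp: edges_A base_edges_def core_edges_def reset_edges_def final_edges_def
        control_edges_def init_edge_def)
  then show halts using inv e(2) assms(3,4) by (auto simp: l sim_inv_def sat_def)
qed

section \<open>Completeness of the simulation\<close>

text \<open>The registers have to be reset in the order of decreasing new values. If two of them are due at the same
  time, the one that reads the other comes first.\<close>

lemma select_register:
  assumes "finite U" "U \<noteq> {}" "q < length P" "mstep P (q, s) (q', s')"
  shows "\<exists>i\<in>U. (\<forall>k\<in>U. s' k \<le> s' i) \<and> (\<forall>k\<in>U - {i}. source (P ! q) k \<noteq> i)"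
proof -
  have "Max (s' ` U) \<in> s' ` U" using assms(1,2) by simp
  then obtain i where "i \<in> U" "s' i = Max (s' ` U)" by auto
  then have i: "i \<in> U" "\<forall>k\<in>U. s' k \<le> s' i" using assms(1) by auto
  show ?thesis
  proof (cases "\<forall>k\<in>U - {i}. source (P ! q) k \<noteq> i")
    case True
    with i show ?thesis by blast
  next
    case False
    then obtain k where k: "k \<in> U" "k \<noteq> i" "source (P ! q) k = i" by blast
    then obtain d q2 where P: "P ! q = Asg k i d q2" by (cases "P ! q") (auto split: if_splits)
    have "0 \<le> d" using wf[OF assms(3)] P k by (simp add: wf_instr_def)
    moreover have "int (s' k) = int (s i) + d" "int (s' i) = int (s i)"
      using assms(4) P k(2) by (auto simp: mstep_def dest: spec[of _ k] spec[of _ i])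
    ultimately have "s' i \<le> s' k" by simp
    with i P k show ?thesis by (intro bexI[of _ k]) (auto intro: le_trans)
  qed
qed

text \<open>Induction on the set \<open>U\<close> of registers still to be reset. The invariant says
  that no reset time \<open>p - s' r\<close> with \<open>r\<close> in \<open>U\<close> has passed
  and that the source clocks of the registers in \<open>U\<close> are not yet reset.\<close>

lemma reset_phase:
  assumes "q < length P" "mstep P (q, s) (q', s')" "\<forall>r\<in>{1..m}. s' r \<le> p" "of_rat (v 0) = real p"
  assumes "U \<subseteq> {1..m}" "simulates p q ({1..m} - U) s w" "w 0 = real t" "t \<le> p" "\<forall>r\<in>U. t \<le> p - s' r"
    "\<And>x. w x \<in> T" "\<forall>r\<in>U. source (P ! q) r \<notin> {1..m} - U"
  shows "\<exists>w' t'. (tr0 v ^^ card U) (loc q ({1..m} - U), w) (loc q {1..m}, w') \<and>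
    simulates p q {1..m} s w' \<and> w' 0 = real t' \<and> t' \<le> p \<and> (\<forall>x. w' x \<in> T)"
  using assms(5-)
proof (induction "card U" arbitrary: U w t)
  case 0
  then have "U = {}" by (metis card_0_eq finite_atLeastAtMost finite_subset)
  then show ?case using 0 by auto
next
  case (Suc n)
  have U: "finite U" "U \<noteq> {}" using Suc.hyps(2) by (auto intro: card_ge_0_finite)
  obtain i where i: "i \<in> U" "\<forall>k\<in>U. s' k \<le> s' i" "\<forall>k\<in>U - {i}. source (P ! q) k \<noteq> i"
    using select_register[OF U assms(1,2)] by blast
  define S where "S = {1..m} - U"
  \<comment> \<open>The source clock is the time plus the old source value, so it equals
    \<open>p\<close> minus the offset at time \<open>p - s' i\<close>; \<open>d\<close> is the delay
    until then.\<close>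
  define d where "d = p - s' i - t"
  define w1 where "w1 = (\<lambda>x. if x \<in> {i} then 0 else w x + real d)"
  have im: "i \<in> {1..m}" using i(1) Suc.prems(1) by blast
  have S: "{1..m} - (U - {i}) = insert i S" using im by (auto simp: S_def)
  have si: "int (s' i) = int (s (source (P ! q) i)) + offset (P ! q) i"
    using assms(2) by (auto simp: mstep_def)
  have si_real: "real (s' i) = real (s (source (P ! q) i)) + real_of_int (offset (P ! q) i)"
    using si by (metis of_int_add of_int_of_nat_eq)
  have sip: "s' i \<le> p" "t \<le> p - s' i" using assms(3) im i(1) Suc.prems(5) by auto
  have d: "real d = real p - real (s' i) - real t" using sip by (simp add: d_def of_nat_diff)
  have src: "source (P ! q) i \<notin> S" using Suc.prems(7) i(1) by (simp add: S_def)
  have edge: "(loc q S, [ClockParam (source (P ! q) i) Eq 0 (- offset (P ! q) i)], 0, {i}, loc q (insert i S)) \<in> edges A"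
  proof -
    have "S \<subseteq> {1..m}" "i \<notin> S" using i(1) by (auto simp: S_def)
    then have "(loc q S, [ClockParam (source (P ! q) i) Eq 0 (- offset (P ! q) i)], 0, {i}, loc q (insert i S))
        \<in> reset_edges P m"
      unfolding reset_edges_def mem_Collect_eq using assms(1) im src by (intro exI conjI) (rule refl | assumption)+
    then show ?thesis by (simp add: edges_A base_edges_def core_edges_def)
  qed
  have wsrc: "w (source (P ! q) i) = real t + real (s (source (P ! q) i))"
    using simulates_unreset[OF Suc.prems(2) source_le[OF assms(1)]] Suc.prems(3) im src by (simp add: S_def)
  have tr: "tr0 v (loc q S, w) (loc q (insert i S), w1)"
    by (rule trI[OF edge T_simps(3)[of d]])
       (use Suc.prems(6) wsrc d si_real in \<open>auto simp: sat_def assms(4) w1_def\<close>)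
  have w10: "w1 0 = real (p - s' i)" using im Suc.prems(3) d sip by (auto simp: w1_def of_nat_diff)
  have "simulates p q (insert i S) s w1"
    using Suc.prems(2,3) im d si_real sip unfolding simulates_def w10
    by (auto simp: w1_def S_def of_nat_diff)
  then have sim: "simulates p q ({1..m} - (U - {i})) s w1" unfolding S .
  have n: "n = card (U - {i})" using Suc.hyps(2) i(1) U by simp
  have "\<forall>r\<in>U - {i}. p - s' i \<le> p - s' r" using i(2) by (auto intro: diff_le_mono2)
  moreover have "\<And>x. w1 x \<in> T" using Suc.prems(6) T_add by (simp add: w1_def)
  moreover have "\<forall>r\<in>U - {i}. source (P ! q) r \<notin> {1..m} - (U - {i})"
    using Suc.prems(7) i(3) by blast
  moreover have "U - {i} \<subseteq> {1..m}" using Suc.prems(1) by blast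
  ultimately obtain w' t' where *: "(tr0 v ^^ n) (loc q (insert i S), w1) (loc q {1..m}, w')"
    "simulates p q {1..m} s w'" "w' 0 = real t'" "t' \<le> p" "\<forall>x. w' x \<in> T"
    using Suc.hyps(1)[OF n _ sim w10] unfolding n[symmetric] S by auto
  have "(tr0 v ^^ Suc n) (loc q S, w) (loc q {1..m}, w')" using tr *(1) by (rule relpowp_Suc_I2)
  then show ?case using * Suc.hyps(2) unfolding S_def by auto
qed

lemma simulate_step:
  assumes "mstep P (q, s) (q', s')" "\<forall>r\<in>{1..m}. s' r \<le> p" "of_rat (v 0) = real p"
    "simulates p q {} s w" "w 0 = 0" "\<And>x. w x \<in> T"
  shows "\<exists>w'. (tr0 v ^^ Suc m) (loc q {}, w) (loc q' {}, w') \<and> simulates p q' {} s' w' \<and> w' 0 = 0 \<and> (\<forall>x. w' x \<in> T)"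
proof -
  have q: "q < length P" using assms(1) by (simp add: mstep_def)
  have s': "int (s' i) = int (s (source (P ! q) i)) + offset (P ! q) i" for i
    using assms(1) by (auto simp: mstep_def)
  then have s'_real: "real (s' i) = real (s (source (P ! q) i)) + real_of_int (offset (P ! q) i)" for i
    by (metis of_int_add of_int_of_nat_eq)
  obtain w1 t where w1: "(tr0 v ^^ m) (loc q {}, w) (loc q {1..m}, w1)"
    "simulates p q {1..m} s w1" "w1 0 = real t" "t \<le> p" "\<And>x. w1 x \<in> T"
    using reset_phase[of q s q' s' p v "{1..m}" w 0] q assms by auto
  define w' where "w' = (\<lambda>x. if x \<in> {0} then 0 else w1 x + real (p - t))"
  have val: "w1 r + real (p - t) = real (s' r)" if "r \<in> {1..m}" for r
    using w1(2-4) that s'_real[of r] by (simp add: simulates_def of_nat_diff)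
  have q': "q' = target (P ! q) s'" using assms(1) by (simp add: mstep_def)
  have "\<exists>g. (g, q') \<in> branches (P ! q) \<and> sat v (\<lambda>x. w1 x + real (p - t)) g"
    using wf[OF q] val unfolding q' by (cases "P ! q") (auto simp: sat_def wf_instr_def)
  then obtain g where g: "(g, q') \<in> branches (P ! q)" "sat v (\<lambda>x. w1 x + real (p - t)) g" by blast
  then have edge: "(loc q {1..m}, ClockParam 0 Eq 0 0 # g, 0, {0}, loc q' {}) \<in> edges A"
    using q by (auto simp: edges_A base_edges_def core_edges_def final_edges_def)
  have "tr0 v (loc q {1..m}, w1) (loc q' {}, w')"
    by (rule trI[OF edge T_simps(3)[of "p - t"]])
      (use g(2) w1 in \<open>auto simp: sat_def assms(3) w'_def of_nat_diff\<close>)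
  then have "(tr0 v ^^ Suc m) (loc q {}, w) (loc q' {}, w')" using w1(1) by (rule relpowp_Suc_I[rotated])
  moreover have "s' 0 = 0" using s'[of 0] offset_0[OF q] assms(4) by (simp add: simulates_def)
  then have "simulates p q' {} s' w'" using val by (auto simp: simulates_def w'_def)
  moreover have "\<forall>x. w' x \<in> T" using w1(5) T_add by (simp add: w'_def)
  ultimately show ?thesis by (auto simp: w'_def)
qed

lemma register_bound:
  assumes "(mstep P ^^ j) (0, s0) (q, s)"
  shows "s r \<le> X + j"
  using assms
proof (induction j arbitrary: q s r)
  case (Suc j)
  then obtain q1 s1 where *: "(mstep P ^^ j) (0, s0) (q1, s1)" "mstep P (q1, s1) (q, s)"
    by (auto elim: relpowp_Suc_E)
  then have "offset (P ! q1) r \<le> 1"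
    using wf[of q1] by (cases "P ! q1") (auto simp: mstep_def wf_instr_def)
  moreover have "int (s r) = int (s1 (source (P ! q1) r)) + offset (P ! q1) r"
    using *(2) by (simp add: mstep_def)
  ultimately show ?case using Suc.IH[OF *(1), of "source (P ! q1) r"] by simp
qed auto

lemma simulate_steps:
  assumes "(mstep P ^^ j) (0, s0) (q, s)" "X + j \<le> p" "of_rat (v 0) = real p"
  shows "\<exists>w. (tr0 v ^^ Suc (Suc m * j)) (0, \<lambda>_. 0) (loc q {}, w) \<and> simulates p q {} s w \<and> w 0 = 0 \<and> (\<forall>x. w x \<in> T)"
  using assms(1,2)
proof (induction j arbitrary: q s)
  case 0
  define w where "w = (\<lambda>x. if x \<in> {..<X} - {1} then 0 else real X)"
  have edge: "(0, [ClockConst 1 Eq (int X)], 0, {..<X} - {1}, loc 0 {}) \<in> edges A"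
    by (simp add: edges_A init_edge_def)
  have "tr0 v (0, \<lambda>_. 0) (loc 0 {}, w)"
    by (rule trI[OF edge T_simps(3)[of X]]) (auto simp: sat_def w_def)
  moreover have "simulates p 0 {} s0 w" using bounds by (auto simp: simulates_def w_def)
  ultimately show ?case using 0 bounds by (auto simp: w_def intro!: exI[of _ w])
next
  case (Suc j)
  then obtain q1 s1 where *: "(mstep P ^^ j) (0, s0) (q1, s1)" "mstep P (q1, s1) (q, s)"
    by (auto elim: relpowp_Suc_E)
  have "s r \<le> p" for r
    using register_bound[OF Suc.prems(1), of r] Suc.prems(2) by simp
  moreover obtain w where w: "(tr0 v ^^ Suc (Suc m * j)) (0, \<lambda>_. 0) (loc q1 {}, w)" "simulates p q1 {} s1 w"
    "w 0 = 0" "\<And>x. w x \<in> T"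
    using Suc.IH[OF *(1)] Suc.prems(2) by auto
  ultimately obtain w' where w': "(tr0 v ^^ Suc m) (loc q1 {}, w) (loc q {}, w')" "simulates p q {} s w'"
    "w' 0 = 0" "\<forall>x. w' x \<in> T"
    using simulate_step[where v = v, OF *(2) _ assms(3)] by blast
  have "(tr0 v ^^ (Suc (Suc m * j) + Suc m)) (0, \<lambda>_. 0) (loc q {}, w')"
    using w(1) w'(1) unfolding relpowp_add by blast
  moreover have "Suc (Suc m * j) + Suc m = Suc (Suc m * Suc j)" by simp
  ultimately show ?case using w' by (metis (no_types))
qed

text \<open>The parameter has to exceed the register values and also the length of the simulation:
  location \<open>2\<close> is reached after \<open>Suc m * j + 2\<close> letters, which must fit
  into the \<open>p + 1\<close> zeros.\<close>

lemma ab_in_language_if_halts: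
  assumes "(mstep P ^^ j) (0, s0) (length P, s)" "X + Suc m * j + 1 \<le> p" "of_rat (v 0) = real p"
  shows "Inf (ab p) \<in> untimed_language T A v"
proof -
  have j: "X + j \<le> p" using assms(2) by simp
  obtain w where w: "(tr0 v ^^ Suc (Suc m * j)) (0, \<lambda>_. 0) (loc (length P) {}, w)" "\<forall>x. w x \<in> T"
    using simulate_steps[where v = v, OF assms(1) j assms(3)] by blast
  have edge: "(loc (length P) {}, [], 0, {}, 2) \<in> edges A"
    by (simp add: edges_A base_edges_def core_edges_def control_edges_def)
  have "tr0 v (loc (length P) {}, w) (2, w)"
    by (rule trI[OF edge T_simps(1)]) (use w(2) in \<open>auto simp: sat_def\<close>)
  with w(1) have "(tr0 v ^^ Suc (Suc (Suc m * j))) (0, \<lambda>_. 0) (2, w)" by (rule relpowp_Suc_I)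
  then show ?thesis by (rule ab_in_languageI) (use assms(2) in auto)
qed

lemma language_preservable_iff:
  assumes V: "V = {0..} \<or> V = \<nat>"
  shows "language_preservable T V (A, \<lambda>_. 0) \<longleftrightarrow> halts"
proof -
  let ?W = "insert (Inf (\<lambda>_. 0)) (range (\<lambda>n. Inf (ab n)))"
  have params: "params A = {0}" by (simp add: machine_pta_def)
  have L0: "untimed_language T A (\<lambda>_. 0) = ?W"
    using language_subset zeros_in_language language_zero by fastforce
  show ?thesis
  proof
    assume "language_preservable T V (A, \<lambda>_. 0)"
    then obtain v where v: "v 0 \<in> V" "v 0 \<noteq> 0" "untimed_language T A v = ?W"
      unfolding language_preservable_def is_valuation_def params prod.case L0 by fastforce
    then have pos: "0 < v 0" using V by (auto elim: Nats_cases)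
    \<comment> \<open>The integer part of \<open>p\<close> is a value of \<open>n\<close> that the
      ticks miss, also if \<open>p\<close> is not an integer.\<close>
    have "\<exists>n. r - 1 < real n \<and> real n < r + 1" if "0 \<le> r" for r :: real
      using that by (intro exI[of _ "nat \<lfloor>r\<rfloor>"]) linarith
    from this[of "of_rat (v 0)"] pos obtain n
      where n: "of_rat (v 0) - 1 < real n" "real n < of_rat (v 0) + 1" by auto
    show halts by (rule halts_if_ab_in_language[where v = v and n = n, OF _ pos n]) (simp add: v(3))
  next
    assume halts
    then obtain j s where j: "(mstep P ^^ j) (0, s0) (length P, s)"
      unfolding halts_def by (auto dest: rtranclp_imp_relpowp)
    define p where "p = X + Suc m * j + 1"
    define v :: "nat \<Rightarrow> rat" where "v = (\<lambda>_. of_nat p)"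
    have vp: "of_rat (v 0) = real p" by (simp add: v_def)
    \<comment> \<open>As \<open>p\<close> is an integer, the ticks miss only \<open>n = p\<close>,
      which the halting simulation supplies.\<close>
    have "Inf (ab n) \<in> untimed_language T A v" for n
    proof (cases "n = p")
      case True
      then show ?thesis using ab_in_language_if_halts[where v = v, OF j _ vp] by (simp add: p_def)
    next
      case False
      then show ?thesis by (intro ticks_in_language) (auto simp: vp)
    qed
    then have "untimed_language T A v = ?W"
      using language_subset zeros_in_language by fastforce
    moreover have "p \<noteq> 0" by (simp add: p_def)
    then have "v 0 \<in> V" "v 0 \<noteq> 0" using V by (auto simp: v_def)
    ultimately show "language_preservable T V (A, \<lambda>_. 0)"
      unfolding language_preservable_def is_valuation_def params prod.case L0 by (intro exI[of _ v]) auto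
  qed
qed

end

section \<open>Diagonalization\<close>

definition computable1 :: "(nat \<Rightarrow> nat) \<Rightarrow> bool" where
  "computable1 F \<longleftrightarrow> (\<exists>f. \<forall>x. computes f [x] (F x))"

definition computable2 :: "(nat \<Rightarrow> nat \<Rightarrow> nat) \<Rightarrow> bool" where
  "computable2 F \<longleftrightarrow> (\<exists>f. \<forall>x y. computes f [x, y] (F x y))"

lemma computes_Proj: "i < length xs \<Longrightarrow> y = xs ! i \<Longrightarrow> computes (Proj i) xs y"
  by (auto intro: computes.intros)

lemma computes_const: "\<exists>f. \<forall>xs. computes f xs c"
proof (induction c)
  case 0
  show ?case by (blast intro: computes.intros)
next
  case (Suc c)
  then obtain f where "\<forall>xs. computes f xs c" by blast
  then have "computes (Comp Succ [f]) xs (Suc c)" for xs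
    by (intro computes.intros(4)[of _ _ "[c]"]) (auto intro: computes.intros)
  then show ?case by blast
qed

lemma computable1_const: "computable1 (\<lambda>x. c)"
  and computable2_const: "computable2 (\<lambda>x y. c)"
  using computes_const unfolding computable1_def computable2_def by blast+

lemma computable1_id: "computable1 (\<lambda>x. x)"
  unfolding computable1_def by (intro exI[of _ "Proj 0"]) (simp add: computes_Proj)

lemma computable2_fst: "computable2 (\<lambda>x y. x)"
  unfolding computable2_def by (intro exI[of _ "Proj 0"]) (simp add: computes_Proj)

lemma computable2_snd: "computable2 (\<lambda>x y. y)"
  unfolding computable2_def by (intro exI[of _ "Proj 1"]) (simp add: computes_Proj)

lemma computable1_Suc: "computable1 Suc"
  unfolding computable1_def by (blast intro: computes.intros)

lemma computable1_comp1:
  assumes "computable1 H" "computable1 F"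
  shows "computable1 (\<lambda>x. H (F x))"
proof -
  obtain h f where "\<And>x. computes h [x] (H x)" "\<And>x. computes f [x] (F x)"
    using assms unfolding computable1_def by blast
  then have "computes (Comp h [f]) [x] (H (F x))" for x
    by (intro computes.intros(4)[of _ _ "[F x]"]) auto
  then show ?thesis unfolding computable1_def by blast
qed

lemma computable2_comp1:
  assumes "computable1 H" "computable2 F"
  shows "computable2 (\<lambda>x y. H (F x y))"
proof -
  obtain h f where "\<And>x. computes h [x] (H x)" "\<And>x y. computes f [x, y] (F x y)"
    using assms unfolding computable1_def computable2_def by blast
  then have "computes (Comp h [f]) [x, y] (H (F x y))" for x y
    by (intro computes.intros(4)[of _ _ "[F x y]"]) auto
  then show ?thesis unfolding computable2_def by blast
qed

lemma computable1_comp2: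
  assumes "computable2 H" "computable1 F" "computable1 G"
  shows "computable1 (\<lambda>x. H (F x) (G x))"
proof -
  obtain h f g where "\<And>x y. computes h [x, y] (H x y)" "\<And>x. computes f [x] (F x)" "\<And>x. computes g [x] (G x)"
    using assms unfolding computable1_def computable2_def by blast
  then have "computes (Comp h [f, g]) [x] (H (F x) (G x))" for x
    by (intro computes.intros(4)[of _ _ "[F x, G x]"]) auto
  then show ?thesis unfolding computable1_def by blast
qed

lemma computable2_comp2:
  assumes "computable2 H" "computable2 F" "computable2 G"
  shows "computable2 (\<lambda>x y. H (F x y) (G x y))"
proof -
  obtain h f g where "\<And>x y. computes h [x, y] (H x y)" "\<And>x y. computes f [x, y] (F x y)"
    "\<And>x y. computes g [x, y] (G x y)"
    using assms unfolding computable2_def by metis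
  then have "computes (Comp h [f, g]) [x, y] (H (F x y) (G x y))" for x y
    by (intro computes.intros(4)[of _ _ "[F x y, G x y]"]) auto
  then show ?thesis unfolding computable2_def by blast
qed

lemma computable1_rec:
  assumes "computable2 H" "F 0 = c" "\<And>n. F (Suc n) = H n (F n)"
  shows "computable1 F"
proof -
  obtain h where h: "\<And>x y. computes h [x, y] (H x y)" using assms(1) unfolding computable2_def by blast
  obtain f where f: "computes f [] c" using computes_const by blast
  have "computes (PrimRec f h) [n] (F n)" for n
    by (induction n) (auto simp: assms(2,3) intro: f h computes.intros)
  then show ?thesis unfolding computable1_def by blast
qed

lemma computable2_add: "computable2 (+)"
proof -
  have "computes (PrimRec (Proj 0) (Comp Succ [Proj 1])) [x, y] (x + y)" for x y
  proof (induction x)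
    case 0
    show ?case by (auto intro!: computes.intros(5) computes_Proj)
  next
    case (Suc x)
    have "computes (Comp Succ [Proj 1]) [x, x + y, y] (Suc (x + y))"
      by (intro computes.intros(4)[of _ _ "[x + y]"]) (auto intro: computes_Proj computes.intros)
    with Suc show ?case by (auto intro: computes.intros)
  qed
  then show ?thesis unfolding computable2_def by blast
qed

lemmas computable_intros =
  computable1_id computable1_const computable1_comp1[OF computable1_Suc] computable1_comp2[OF computable2_add]
  computable2_fst computable2_snd computable2_const computable2_comp1[OF computable1_Suc]
  computable2_comp2[OF computable2_add]

lemma computable1_pred: "computable1 (\<lambda>x. x - 1)"
  by (rule computable1_rec[of "\<lambda>x y. x" _ 0]) (auto intro: computable_intros)

lemma computable1_power2: "computable1 (\<lambda>x. 2 ^ x)"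
  by (rule computable1_rec[of "\<lambda>x y. y + y" _ 1]) (auto intro!: computable_intros)

lemma computable1_triangle: "computable1 triangle"
  by (rule computable1_rec[of "\<lambda>x y. y + Suc x" _ 0]) (auto intro!: computable_intros)

lemma computable2_prod_encode: "computable2 (\<lambda>x y. prod_encode (x, y))"
  unfolding prod_encode_def prod.case
  by (intro computable_intros computable2_comp1[OF computable1_triangle])

lemma computable1_replicate: "computable1 (\<lambda>x. list_encode (replicate x 0))"
  by (rule computable1_rec[of "\<lambda>x y. Suc (prod_encode (0, y))" _ 0])
    (auto intro!: computable_intros computable2_comp2[OF computable2_prod_encode])

text \<open>This is to be the code of \<open>init_edge x\<close>: \<open>x + x\<close> is the
  integer code of \<open>x\<close>, and \<open>{..<x}\<close> has code \<open>2 ^ x - 1\<close>,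
  from which removing the element \<open>1\<close> takes \<open>2\<close>. The subtraction is
  iterated so that the predecessor function suffices.\<close>

definition init_code :: "nat \<Rightarrow> nat" where
  "init_code x = list_encode [0, list_encode [list_encode [3, 1, 2, x + x]], 0, 2 ^ x - 1 - 1 - 1, 5]"

text \<open>The code of the instance is computed from the code \<open>x\<close> of its set of edges without the
  initial one. As the locations and clocks are numbered up to \<open>x\<close>, nothing has to be decoded.\<close>

definition diagonal_code :: "nat \<Rightarrow> nat" where
  "diagonal_code x = prod_encode
     (list_encode [3, 2 ^ x - 1, 0, 2 ^ x - 1, 1, list_encode (replicate x 0), x + 2 ^ init_code x],
      list_encode [rat_code 0])"

lemma computable1_list_encode_Cons:
  "computable1 F \<Longrightarrow> computable1 (\<lambda>x. list_encode (G x)) \<Longrightarrow> computable1 (\<lambda>x. list_encode (F x # G x))"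
  unfolding list_encode.simps by (intro computable_intros computable1_comp2[OF computable2_prod_encode])

lemma computable1_list_encode_Nil: "computable1 (\<lambda>x. list_encode [])"
  unfolding list_encode.simps by (rule computable_intros)

lemma computable1_diagonal_code: "computable1 diagonal_code"
proof -
  have init: "computable1 init_code"
    unfolding init_code_def[abs_def]
    by (intro computable1_list_encode_Cons computable1_list_encode_Nil computable1_const computable1_comp1[OF computable1_pred]
        computable1_power2 computable1_comp2[OF computable2_add] computable1_id)
  show ?thesis
    unfolding diagonal_code_def[abs_def]
    by (intro computable1_comp2[OF computable2_prod_encode] computable1_list_encode_Cons computable1_list_encode_Nil
        computable1_const computable1_comp1[OF computable1_pred] computable1_power2 computable1_comp2[OF computable2_add]
        computable1_id computable1_replicate computable1_comp1[OF computable1_power2] init)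
qed

section \<open>The code of the diagonal instance\<close>

lemma set_encode_lessThan: "set_encode {..<n} = 2 ^ n - 1"
  by (induction n) (auto simp: lessThan_Suc)

lemma set_encode_lessThan_Diff: "1 < n \<Longrightarrow> set_encode ({..<n} - {1}) = 2 ^ n - 1 - 1 - 1"
proof -
  assume "1 < n"
  then have "{..<n} = insert 1 ({..<n} - {1})" by auto
  then have "set_encode {..<n} = 2 + set_encode ({..<n} - {1})"
    by (metis finite_Diff finite_lessThan set_encode_insert Diff_iff insertI1 power_one_right)
  then show ?thesis unfolding set_encode_lessThan by simp
qed

lemma less_set_encode: "finite A \<Longrightarrow> n \<in> A \<Longrightarrow> n < set_encode A"
proof -
  assume A: "finite A" "n \<in> A"
  have "n < 2 ^ n" by (rule less_exp)
  also have "2 ^ n \<le> set_encode A" unfolding set_encode_def using A by (auto intro: member_le_sum)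
  finally show ?thesis .
qed

text \<open>The self-reference: with \<open>X\<close> the code of all edges but the initial one, the
  input \<open>X\<close> of the machine determines the code of the very instance that simulates
  it.\<close>

lemma instance_code_machine_pta:
  assumes "1 < X" and X: "X = set_encode (edge_code ` base_edges P m N)"
  shows "instance_code (machine_pta P m N X, \<lambda>_. 0) = diagonal_code X"
proof -
  have "int_encode (int X) = X + X" by (simp add: int_encode_def sum_encode_def)
  then have "edge_code (init_edge X) = init_code X"
    using set_encode_lessThan_Diff[OF assms(1)]
    by (simp add: init_edge_def edge_code_def init_code_def constr_code_def loc_0_empty del: list_encode.simps)
  moreover have "edge_code (init_edge X) \<notin> edge_code ` base_edges P m N"
  proof
    assume "edge_code (init_edge X) \<in> edge_code ` base_edges P m N"
    then obtain e where e: "e \<in> base_edges P m N" "edge_code e = edge_code (init_edge X)" by auto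
    have "e \<in> {(l, g, a, R, l'). finite R}"
      using e(1) by (auto simp: base_edges_def core_edges_def reset_edges_def final_edges_def control_edges_def)
    then have "e = init_edge X"
      by (rule inj_onD[OF inj_on_edge_code e(2)]) (simp add: init_edge_def)
    with e(1) init_edge_notin show False by simp
  qed
  ultimately have "set_encode (edge_code ` edges (machine_pta P m N X)) = X + 2 ^ init_code X"
    using X finite_base_edges[of P m N] by (simp add: machine_pta_def)
  moreover have "set_encode {0, 1} = 3" "set_encode {0} = 1" by simp_all
  moreover have "map (constr_code \<circ> (\<lambda>_. [])) xs = replicate (length xs) 0" for xs :: "nat list"
    by (simp add: constr_code_def comp_def map_replicate_const)
  ultimately show ?thesis
    by (simp add: instance_code_def pta_code_def diagonal_code_def machine_pta_def set_encode_lessThan numeral_3_eq_3 del: list_encode.simps)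
qed

text \<open>By determinism there is only one run from \<open>c\<close>, and it stays at the fixed
  point \<open>c'\<close> once there, so every configuration on it still leads to \<open>c'\<close>.
  This rules out that a looping machine also halts.\<close>

lemma mstep_loop:
  assumes "(mstep P)\<^sup>*\<^sup>* c c'" "mstep P c' c'" "(mstep P)\<^sup>*\<^sup>* c d"
  shows "(mstep P)\<^sup>*\<^sup>* d c'"
  using assms(1,3)
proof (induction rule: converse_rtranclp_induct)
  case base
  from this have "d = c'"
    by (induction rule: rtranclp_induct) (use mstep_deterministic[OF assms(2)] in blast)+
  then show ?case by simp
next
  case (step y z)
  from step.prems show ?case
  proof (cases rule: converse_rtranclpE)
    case base
    then show ?thesis using step.hyps by auto
  next
    case (step z')
    then show ?thesis using mstep_deterministic[OF \<open>mstep P y z\<close>] step.IH by blast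
  qed
qed

theorem theorem3p1:
  fixes T :: "real set" and V :: "rat set"
  assumes time: "T = {0..} \<or> T = \<nat>"
    and param_domain: "V = {0..} \<or> V = \<nat>"
  shows "\<not> decidable instance_code (instances 1 V) (language_preservable T V)"
proof
  assume "decidable instance_code (instances 1 V) (language_preservable T V)"
  then obtain f where f: "\<And>i. i \<in> instances 1 V \<Longrightarrow>
      computes f [instance_code i] (if language_preservable T V i then 1 else 0)"
    unfolding decidable_def by blast
  obtain g where g: "\<And>x. computes g [x] (diagonal_code x)"
    using computable1_diagonal_code unfolding computable1_def by blast
  \<comment> \<open>Input in register \<open>1\<close>, answer in register \<open>2\<close>, scratch
    space from \<open>3\<close> on.\<close>
  define c where "c = compile (Comp f [g]) [1] 2 3"
  define L where "L = length (code 0 c)"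
  \<comment> \<open>The last instruction inverts the answer: on \<open>0\<close> it jumps to the
    halting address \<open>Suc L\<close>, otherwise it repeats itself forever.\<close>
  define P where "P = code 0 c @ [Test 2 (Suc L) L]"
  have len: "length P = Suc L" by (simp add: P_def L_def)
  obtain m' where m': "\<forall>ins\<in>set (code 0 c). wf_instr m' ins"
    using wf_code[OF wf_compile(1)[of 2 3 "Comp f [g]" "[1]"], of 0] unfolding c_def by auto
  define m where "m = max m' 2"
  have wf: "wf_instr m (P ! q)" if "q < length P" for q
  proof -
    have "P ! q \<in> set P" using that by (rule nth_mem)
    then show ?thesis using m' wf_instr_mono[of m' _ m] by (auto simp: P_def m_def wf_instr_def[of _ "Test _ _ _"])
  qed
  have "finite (fst ` core_edges P m \<union> (\<lambda>(l, g, a, R, l'). l') ` core_edges P m \<union> {m, 5})"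
    by (simp add: finite_core_edges)
  then obtain N where N: "\<forall>x\<in>fst ` core_edges P m \<union> (\<lambda>(l, g, a, R, l'). l') ` core_edges P m \<union> {m, 5}. x < N"
    unfolding finite_nat_set_iff_bounded by blast
  \<comment> \<open>Not circular: \<open>base_edges\<close> is fixed before \<open>X\<close>, which
    enters only through the initial edge and the sets of names.\<close>
  define X where "X = set_encode (edge_code ` base_edges P m N)"
  have "N \<le> X"
  proof -
    \<comment> \<open>The code of an edge exceeds its source location, and the code of a set exceeds
      its elements.\<close>
    have "(N - 1, [], 0, {}, 1) \<in> base_edges P m N" using N by (auto simp: base_edges_def)
    then have "edge_code (N - 1, [], 0, {}, 1) < X"
      unfolding X_def by (intro less_set_encode) (auto simp: finite_base_edges)
    moreover have "N - 1 < edge_code (N - 1, [], 0, {}, 1)"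
      by (simp add: edge_code_def less_Suc_eq_le le_prod_encode_1)
    ultimately show ?thesis by simp
  qed
  interpret machine P m N X T
  proof
    fix l g a R l' assume "(l, g, a, R, l') \<in> core_edges P m"
    then have "l \<in> fst ` core_edges P m" "l' \<in> (\<lambda>(l, g, a, R, l'). l') ` core_edges P m"
      by (auto intro: rev_image_eqI)
    then show "l < N \<and> l' < N" using N by blast
  qed (use wf N \<open>N \<le> X\<close> time in \<open>auto simp: m_def\<close>)
  have inst: "(A, \<lambda>_. 0) \<in> instances 1 V"
    using is_pta_A param_domain by (auto simp: instances_def is_valuation_def machine_pta_def)
  define y :: nat where "y = (if halts then 1 else 0)"
  have "instance_code (A, \<lambda>_. 0) = diagonal_code X"
    using instance_code_machine_pta[OF _ X_def] bounds by simp
  then have "computes f [diagonal_code X] y"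
    using f[OF inst] by (simp add: y_def language_preservable_iff[OF param_domain])
  then have "computes (Comp f [g]) [X] y"
    using g by (intro computes.intros(4)[of _ _ "[diagonal_code X]"]) auto
  then obtain t where t: "exec c s0 t" "t 2 = y"
    using compile_correctD[OF exec_compile, of "Comp f [g]" "[X]" y s0 "[1]" 3 2] unfolding c_def by auto
  have run: "(mstep P)\<^sup>*\<^sup>* (0, s0) (L, t)"
    using exec_code[OF t(1), of P "[]" 0 "[Test 2 (Suc L) L]"] by (simp add: P_def L_def)
  have last: "mstep P (L, t) (if y = 0 then Suc L else L, t)"
    using mstep_Test[of L P 2 "Suc L" L t] t(2) by (simp add: P_def L_def nth_append)
  \<comment> \<open>If the machine halts, the answer is \<open>1\<close> and the run is caught at
    \<open>L\<close>; if it does not halt, the answer is \<open>0\<close> and the run goes on to the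
    halting address.\<close>
  show False
  proof (cases halts)
    case True
    then obtain s where "(mstep P)\<^sup>*\<^sup>* (0, s0) (Suc L, s)" by (auto simp: halts_def len)
    then have "(mstep P)\<^sup>*\<^sup>* (Suc L, s) (L, t)"
      using mstep_loop[OF run] last True by (simp add: y_def)
    then show False
      by (cases rule: converse_rtranclpE) (auto simp: mstep_def len)
  next
    case False
    then have "(mstep P)\<^sup>*\<^sup>* (0, s0) (Suc L, t)" using run last by (simp add: y_def)
    with False show False unfolding halts_def len by blast
  qed
qed

end
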